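(* Let $a,b,c$ be nonnegative integers with $a+1\geqslant b$, $a+1\geqslant c$, $b+1\geqslant c$. Then \[F(a,b,c)=\sum_{\lambda}q^{\mathsf{area}(\lambda)}t^{\mathsf{stat}(\lambda)},\] where the sum runs over all integer triples $\lambda=(x,y,z)$ with $x\geqslant y\geqslant z\geqslant 0$, $x\leqslant a+b+c$, $y\leqslant b+c$, $z\leqslant c$ (i.e. all partitions contained in $\lambda(a,b,c)=(a+b+c,b+c,c)$), and the statistics are defined as follows. Let $L=a+b+c$, $A=a+2b+3c$, $\epsilon_{yz}=\max(0,y+z-b-c)$, and $\mathsf{area}(\lambda)=A-x-y-z$. Then \begin{itemize} \item if $z\geqslant \min(b+c-x,\lceil\frac{y-a}{2}\rceil)$ and $x+y-z+2\epsilon_{yz}<L$: $\mathsf{stat}(\lambda)=x+\max\big(0,\lceil\frac{y-a}{2}\rceil,\,y+z-b-c,\,\lceil\frac{2y+z-L}{2}\rceil\big)$; \item if $z\geqslant \min(b+c-x,\lceil\frac{y-a}{2}\rceil)$, $x+y-z+2\epsilon_{yz}\geqslant L$ and $y+z<b+c$: $\mathsf{stat}(\lambda)=-L+2x+y-z+\max\big(0,\lceil\frac{L+z-x-a}{2}\rceil\big)$; \item if $z\geqslant \min(b+c-x,\lceil\frac{y-a}{2}\rceil)$, $x+y-z+2\epsilon_{yz}\geqslant L$ and $y+z\geqslant b+c$: $\mathsf{stat}(\lambda)=2x+3y+z-(a+3b+3c)+\max\big(0,\lceil\frac{2b+2c-x-y}{2}\rceil,\,a+2b+2c-x-2y\big)$;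 \item if $z<\min(b+c-x,\lceil\frac{y-a}{2}\rceil)$: $\mathsf{stat}(\lambda)=y+z$. \end{itemize}
   Context: Let $q,t$ be indeterminates. For $n\geqslant 1$, a standard Young tableau $T$ with $n$ boxes is a bijective filling of the Young diagram of a partition of $n$ by $1,\dots,n$, increasing along rows (left to right) and columns (bottom to top); rows $r=1,2,\dots$ are counted from the bottom, columns $c=1,2,\dots$ from the left. For $1\leqslant i\leqslant n$ let $z_i=q^{c-1}t^{r-1}$ where $i$ sits in row $r$, column $c$ (so $z_1=1$). Define \[\mathrm{wt}(T)=\prod_{i=2}^{n}\frac{1}{(1-z_i^{-1})(1-qtz_{i-1}/z_i)}\prod_{1\leqslant i<j\leqslant n}\frac{(1-z_i/z_j)(1-qtz_i/z_j)}{(1-qz_i/z_j)(1-tz_i/z_j)},\] omitting any individual factor (numerator or denominator) that vanishes. For integers $a_2,\dots,a_n$, $F(a_2,\dots,a_n)=\sum_T z_2^{a_2}\cdots z_n^{a_n}\mathrm{wt}(T)$ over all standard Young tableaux with $n$ boxes. $F(a,b,c)$ is the case $n=4$. *)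

theory Defs
  imports Complex_Main "HOL-Computational_Algebra.Computational_Algebra"
begin

text \<open>
  The field \<open>\<rat>(q,t)\<close>, realised as the field of fractions of \<open>\<rat>[q][t]\<close>:
  the inner polynomial variable is \<open>q\<close>, the outer one is \<open>t\<close>.
\<close>

type_synonym qt_field = "rat poly poly fract"

definition q :: qt_field where
  "q = Fract [:[:0, 1:]:] 1"

definition t :: qt_field where
  "t = Fract [:0, 1:] 1"

definition is_partition :: "nat \<Rightarrow> nat list \<Rightarrow> bool" where
  "is_partition n \<mu> \<longleftrightarrow> sorted_wrt (\<ge>) \<mu> \<and> 0 \<notin> set \<mu> \<and> sum_list \<mu> = n"

text \<open>Cells are pairs (row, column), both counted from 1; row 1 is the bottom row.\<close>

definition diagram :: "nat list \<Rightarrow> (nat \<times> nat) set" where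
  "diagram \<mu> = {(r, c). 1 \<le> r \<and> r \<le> length \<mu> \<and> 1 \<le> c \<and> c \<le> \<mu> ! (r - 1)}"

text \<open>
  A tableau is a shape together with its filling; the filling takes the dummy value 0 outside
  the diagram, so that each tableau is represented exactly once.
\<close>

definition SYT :: "nat \<Rightarrow> (nat list \<times> (nat \<times> nat \<Rightarrow> nat)) set" where
  "SYT n = {(\<mu>, T).
     is_partition n \<mu> \<and>
     bij_betw T (diagram \<mu>) {1..n} \<and>
     (\<forall>x. x \<notin> diagram \<mu> \<longrightarrow> T x = 0) \<and>
     (\<forall>r c c'. (r, c) \<in> diagram \<mu> \<and> (r, c') \<in> diagram \<mu> \<and> c < c' \<longrightarrow> T (r, c) < T (r, c')) \<and>
     (\<forall>r r' c. (r, c) \<in> diagram \<mu> \<and> (r', c) \<in> diagram \<mu> \<and> r < r' \<longrightarrow> T (r, c) < T (r', c))}"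

definition zval :: "nat list \<times> (nat \<times> nat \<Rightarrow> nat) \<Rightarrow> nat \<Rightarrow> qt_field" where
  "zval = (\<lambda>(\<mu>, T) i. case the_inv_into (diagram \<mu>) T i of (r, c) \<Rightarrow> q ^ (c - 1) * t ^ (r - 1))"

text \<open>Omitting a vanishing factor amounts to replacing it by 1.\<close>

definition omit0 :: "qt_field \<Rightarrow> qt_field" where
  "omit0 x = (if x = 0 then 1 else x)"

definition wt :: "nat \<Rightarrow> (nat \<Rightarrow> qt_field) \<Rightarrow> qt_field" where
  "wt n z =
     (\<Prod>i\<in>{2..n}. 1 / (omit0 (1 - inverse (z i)) * omit0 (1 - q * t * z (i - 1) / z i))) *
     (\<Prod>(i, j)\<in>{(i, j). 1 \<le> i \<and> i < j \<and> j \<le> n}.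
        (omit0 (1 - z i / z j) * omit0 (1 - q * t * z i / z j)) /
        (omit0 (1 - q * z i / z j) * omit0 (1 - t * z i / z j)))"

text \<open>
  The argument \<open>as\<close> is the list of exponents \<open>[a\<^sub>2, \<dots>, a\<^sub>n]\<close>, so \<open>n = length as + 1\<close>
  and \<open>a\<^sub>i\<close> is the list entry with index \<open>i - 2\<close>.
\<close>

definition F :: "int list \<Rightarrow> qt_field" where
  "F as = (let n = length as + 1 in
     \<Sum>S\<in>SYT n. (\<Prod>i\<in>{2..n}. zval S i powi (as ! (i - 2))) * wt n (zval S))"

definition half_ceil :: "int \<Rightarrow> int" where
  "half_ceil m = \<lceil>rat_of_int m / 2\<rceil>"

definition subpartitions :: "int \<Rightarrow> int \<Rightarrow> int \<Rightarrow> (int \<times> int \<times> int) set" where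
  "subpartitions a b c =
     {(x, y, z). x \<ge> y \<and> y \<ge> z \<and> z \<ge> 0 \<and> x \<le> a + b + c \<and> y \<le> b + c \<and> z \<le> c}"

definition area :: "int \<Rightarrow> int \<Rightarrow> int \<Rightarrow> int \<times> int \<times> int \<Rightarrow> int" where
  "area a b c = (\<lambda>(x, y, z). (a + 2 * b + 3 * c) - x - y - z)"

definition stat :: "int \<Rightarrow> int \<Rightarrow> int \<Rightarrow> int \<times> int \<times> int \<Rightarrow> int" where
  "stat a b c = (\<lambda>(x, y, z).
     let L = a + b + c; \<epsilon> = max 0 (y + z - b - c) in
     if z \<ge> min (b + c - x) (half_ceil (y - a)) then
       if x + y - z + 2 * \<epsilon> < L then
         x + Max {0, half_ceil (y - a), y + z - b - c, half_ceil (2 * y + z - L)}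
       else if y + z < b + c then
         - L + 2 * x + y - z + max 0 (half_ceil (L + z - x - a))
       else
         2 * x + 3 * y + z - (a + 3 * b + 3 * c) +
           Max {0, half_ceil (2 * b + 2 * c - x - y), a + 2 * b + 2 * c - x - 2 * y}
     else y + z)"

end

theory Submission
  imports Defs
begin

text \<open>
  Multiplying by \<open>q - t\<close> turns both sides into sums of antisymmetric brackets
  \<open>[m, n] = q\<^sup>m t\<^sup>n - q\<^sup>n t\<^sup>m\<close>. With \<open>A = a + 2b + 3c\<close>, both are equal to the sum of
  \<open>[A + 1 - 2y - z, y + max 0 (y + z - b - c)]\<close> over \<open>0 \<le> z \<le> c\<close> and \<open>z \<le> y \<le> b + c\<close>.
  For the tableaux this is a double geometric sum, whose closed form consists of the
  contributions of the ten tableaux.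

  For the partitions, multiplication by \<open>q - t\<close> telescopes along chains on which the area drops
  by one and the statistic rises by one at each step. The remaining chain ends are compared with
  the bracket sum by plotting \<open>q\<^bsup>A+1-s\<^esup> t\<^sup>n\<close> at the point \<open>(s, n)\<close>: away from the line
  \<open>n = s - b - c\<close> they agree point by point, and on this line the difference is invariant under
  the exchange of \<open>q\<close> and \<open>t\<close>, so it cancels in the brackets.
\<close>

section \<open>Chains of partitions\<close>

lemma half_ceil_le_iff: "half_ceil k \<le> m \<longleftrightarrow> k \<le> 2 * m"
  unfolding half_ceil_def by (simp add: ceiling_le_iff) linarith

lemma less_half_ceil_iff: "m < half_ceil k \<longleftrightarrow> 2 * m < k"
  using half_ceil_le_iff[of k m] by linarith

lemma half_ceil_bounds: "k \<le> 2 * half_ceil k" "2 * half_ceil k \<le> k + 1"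
  using half_ceil_le_iff[of k "half_ceil k"] less_half_ceil_iff[of "half_ceil k - 1" k] by auto

lemma sum_telescope_int:
  fixes g :: "int \<Rightarrow> 'a::ab_group_add"
  assumes "l \<le> u"
  shows "(\<Sum>x\<in>{l..<u}. g x - g (x + 1)) = g l - g u"
  using assms
proof (induction u rule: int_ge_induct)
  case (step u)
  have "{l..<u + 1} = insert u {l..<u}" using step.hyps by auto
  then show ?case using step.IH by simp
qed simp

lemma finite_int_pairs:
  fixes S :: "(int \<times> int) set"
  assumes "\<And>x y. (x, y) \<in> S \<Longrightarrow> \<bar>x\<bar> \<le> N \<and> \<bar>y\<bar> \<le> N"
  shows "finite S"
  by (rule finite_subset[of _ "{-N..N} \<times> {-N..N}"]) (use assms in \<open>force+\<close>)

text \<open>\<open>S\<close> is cut into segments formed by the points \<open>mk p x\<close> with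
  \<open>lo p <= x < hi p\<close>, and each segment telescopes to its two ends. An empty segment,
  \<open>lo p = hi p\<close>, contributes zero, so \<open>I\<close> may contain indices over which
  \<open>S\<close> has no point.\<close>

lemma sum_fibres_telescope:
  fixes g :: "int \<times> int \<Rightarrow> int \<Rightarrow> 'a::ab_group_add"
  assumes "finite I" and "\<And>p. p \<in> I \<Longrightarrow> lo p \<le> hi p"
    and "\<And>l. l \<in> S \<Longrightarrow> base l \<in> I \<and> lo (base l) \<le> pos l \<and> pos l < hi (base l) \<and> mk (base l) (pos l) = l"
    and "\<And>p x. p \<in> I \<Longrightarrow> lo p \<le> x \<Longrightarrow> x < hi p \<Longrightarrow> mk p x \<in> S \<and> base (mk p x) = p \<and> pos (mk p x) = x"
    and "\<And>l. l \<in> S \<Longrightarrow> f l = g (base l) (pos l) - g (base l) (pos l + 1)"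
  shows "sum f S = (\<Sum>p\<in>I. g p (lo p) - g p (hi p))"
proof -
  have "sum f S = (\<Sum>(p, x)\<in>(SIGMA p:I. {lo p..<hi p}). g p x - g p (x + 1))"
    by (rule sum.reindex_bij_witness[of _ "\<lambda>(p, x). mk p x" "\<lambda>l. (base l, pos l)"]) (use assms in auto)
  also have "\<dots> = (\<Sum>p\<in>I. \<Sum>x\<in>{lo p..<hi p}. g p x - g p (x + 1))"
    by (rule sum.Sigma[symmetric]) (use assms in auto)
  also have "\<dots> = (\<Sum>p\<in>I. g p (lo p) - g p (hi p))"
    by (rule sum.cong) (use assms in \<open>auto simp: sum_telescope_int\<close>)
  finally show ?thesis .
qed

section \<open>The four cases of the statistic and their segments\<close>

locale triple =
  fixes a b c :: int
  assumes nonneg: "a \<ge> 0" "b \<ge> 0" "c \<ge> 0"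
    and near: "a + 1 \<ge> b" "a + 1 \<ge> c" "b + 1 \<ge> c"
begin

definition box where
  "box = {(y, z). y \<ge> z \<and> z \<ge> 0 \<and> y \<le> b + c \<and> z \<le> c}"

text \<open>
  \<open>C1\<close>, .., \<open>C4\<close> below are the four cases in the definition of the statistic. They are cut into
  segments along \<open>x\<close>, \<open>y\<close>, \<open>z\<close> and \<open>y\<close> respectively, indexed by \<open>I1\<close>, .., \<open>I4\<close>; a segment of
  \<open>C1\<close> stops before \<open>x = X y z\<close> and may be empty.
\<close>

definition I1 where
  "I1 = {(y, z). (y, z) \<in> box \<and> (y \<le> a + 2 * z \<or> y + z \<ge> b + c) \<and> 2 * y - z + 2 * max 0 (y + z - b - c) \<le> a + b + c}"

definition I2 where
  "I2 = {(x, z). 0 \<le> z \<and> z \<le> c \<and> x \<le> a + b + c \<and> x \<ge> b + c - z \<and> x > a + 2 * z}"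

definition I3 where
  "I3 = {(x, y). b \<le> y \<and> y \<le> b + c \<and> y \<le> x \<and> x \<le> a + b + c \<and> x + 3 * y \<ge> a + 3 * b + 2 * c}"

definition I4 where
  "I4 = {(x, z). 0 \<le> z \<and> x > a + 2 * z \<and> x < b + c - z}"

text \<open>Since \<open>2 * y + z - (a + b + c)\<close> is the sum of \<open>y - a\<close> and
  \<open>y + z - b - c\<close>, the signs and the order of these two numbers decide which entry is
  the maximum. The later case distinctions on \<open>C1\<close> follow this pattern.\<close>

definition E where
  "E y z = max 0 (max (half_ceil (y - a)) (max (y + z - b - c) (half_ceil (2 * y + z - (a + b + c)))))"

definition X where "X y z = a + b + c - y + z - 2 * max 0 (y + z - b - c)"

definition M where "M x y = max 0 (max (half_ceil (2 * b + 2 * c - x - y)) (a + 2 * b + 2 * c - x - 2 * y))"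

definition "C1 = {(x, y, z). (x, y, z) \<in> subpartitions a b c \<and> (z \<ge> b + c - x \<or> y \<le> a + 2 * z) \<and>
    x + y - z + 2 * max 0 (y + z - b - c) < a + b + c}"
definition "C2 = {(x, y, z). (x, y, z) \<in> subpartitions a b c \<and> (z \<ge> b + c - x \<or> y \<le> a + 2 * z) \<and>
    \<not> x + y - z + 2 * max 0 (y + z - b - c) < a + b + c \<and> y + z < b + c}"
definition "C3 = {(x, y, z). (x, y, z) \<in> subpartitions a b c \<and> (z \<ge> b + c - x \<or> y \<le> a + 2 * z) \<and>
    \<not> x + y - z + 2 * max 0 (y + z - b - c) < a + b + c \<and> \<not> y + z < b + c}"
definition "C4 = {(x, y, z). (x, y, z) \<in> subpartitions a b c \<and> z < b + c - x \<and> y > a + 2 * z}"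

lemma cond_iff: "z \<ge> min (b + c - x) (half_ceil (y - a)) \<longleftrightarrow> z \<ge> b + c - x \<or> y \<le> a + 2 * z"
  using half_ceil_le_iff[of "y - a" z] by auto

lemma stat_C1: "(x, y, z) \<in> C1 \<Longrightarrow> stat a b c (x, y, z) = x + E y z"
  by (simp add: C1_def stat_def Let_def cond_iff E_def)

lemma stat_C2: "stat a b c (x, y, z) = 2 * x + y - z - (a + b + c) + max 0 (half_ceil (b + c + z - x))"
  if "(x, y, z) \<in> C2"
proof -
  from that have *: "z \<ge> b + c - x \<or> y \<le> a + 2 * z"
      "(x + y - z + 2 * max 0 (y + z - b - c) < a + b + c) = False" "(y + z < b + c) = True"
    by (auto simp: C2_def)
  have eq: "a + b + c + z - x - a = b + c + z - x" by simp
  show ?thesis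
    unfolding stat_def Let_def prod.case cond_iff *(2,3) eq using *(1) by simp
qed

lemma stat_C3: "stat a b c (x, y, z) = 2 * x + 3 * y + z - (a + 3 * b + 3 * c) + M x y"
  if "(x, y, z) \<in> C3"
proof -
  from that have *: "z \<ge> b + c - x \<or> y \<le> a + 2 * z"
      "(x + y - z + 2 * max 0 (y + z - b - c) < a + b + c) = False" "(y + z < b + c) = False"
    by (auto simp: C3_def)
  show ?thesis
    unfolding stat_def Let_def prod.case cond_iff *(2,3) M_def using *(1) by simp
qed

lemma stat_C4: "(x, y, z) \<in> C4 \<Longrightarrow> stat a b c (x, y, z) = y + z"
  by (simp add: C4_def stat_def Let_def cond_iff)

lemma finite_box: "finite box"
  by (rule finite_int_pairs[of _ "a + b + c"]) (use nonneg in \<open>auto simp: box_def\<close>)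

lemma finite_I1: "finite I1"
  by (rule finite_subset[OF _ finite_box]) (auto simp: I1_def)

lemma finite_I2: "finite I2"
  by (rule finite_int_pairs[of _ "a + b + c"]) (use nonneg in \<open>auto simp: I2_def\<close>)

lemma finite_I3: "finite I3"
  by (rule finite_int_pairs[of _ "a + b + c"]) (use nonneg in \<open>auto simp: I3_def\<close>)

lemma finite_I4: "finite I4"
  by (rule finite_int_pairs[of _ "a + b + c"]) (use nonneg in \<open>auto simp: I4_def\<close>)

lemma finite_subpartitions: "finite (subpartitions a b c)"
  by (rule finite_subset[of _ "{0..a+b+c} \<times> {0..b+c} \<times> {0..c}"]) (auto simp: subpartitions_def)

context
  fixes w :: "int \<Rightarrow> int \<Rightarrow> 'a::ab_group_add"
begin

text \<open>For \<open>w m n = q powi m * t powi n\<close> this is q - t times the term of the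
  partition \<open>l\<close>. Keeping \<open>w\<close> arbitrary turns what follows into a matching
  of exponent pairs.\<close>

definition "f l = w (area a b c l + 1) (stat a b c l) - w (area a b c l) (stat a b c l + 1)"

text \<open>Membership in \<open>C1\<close> mentions \<open>x\<close>, but the range over each
  \<open>(y, z)\<close> is an interval: if \<open>z >= b + c - x\<close> then the inequality
  defining \<open>C1\<close> forces \<open>y < a + 2 * z\<close>. As \<open>E y z\<close> does not
  involve \<open>x\<close>, the statistic rises by one with \<open>x\<close>.\<close>

lemma sum_C1: "sum f C1 = (\<Sum>(y, z)\<in>I1. w (a + 2 * b + 3 * c + 1 - 2 * y - z) (y + E y z)
    - w (a + 2 * b + 3 * c + 1 - X y z - y - z) (X y z + E y z))"
proof -
  have "sum f C1 = (\<Sum>p\<in>I1. (\<lambda>(y, z) x. w (a + 2 * b + 3 * c + 1 - x - y - z) (x + E y z)) p (fst p)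
      - (\<lambda>(y, z) x. w (a + 2 * b + 3 * c + 1 - x - y - z) (x + E y z)) p (case_prod X p))"
  proof (rule sum_fibres_telescope[where base = "\<lambda>(x, y, z). (y, z)" and pos = fst and mk = "\<lambda>(y, z) x. (x, y, z)"])
    show "finite I1" by (rule finite_I1)
  next
    fix l assume l: "l \<in> C1"
    obtain x y z where xyz: "l = (x, y, z)" by (cases l) auto
    show "f l = (\<lambda>(y, z) x. w (a + 2 * b + 3 * c + 1 - x - y - z) (x + E y z)) (case l of (x, y, z) \<Rightarrow> (y, z)) (fst l) -
      (\<lambda>(y, z) x. w (a + 2 * b + 3 * c + 1 - x - y - z) (x + E y z)) (case l of (x, y, z) \<Rightarrow> (y, z)) (fst l + 1)"
      using l unfolding xyz by (simp add: f_def stat_C1 area_def algebra_simps)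
  qed (use nonneg near in \<open>auto simp: I1_def X_def C1_def box_def subpartitions_def max_def split: if_splits\<close>)
  then show ?thesis by (simp add: case_prod_unfold algebra_simps)
qed

text \<open>The range of \<open>y\<close> is nonempty exactly when \<open>x > a + 2 * z\<close>. A
  point with \<open>x < b + c - z\<close> would have \<open>y > a + 2 * z\<close> and violate both
  alternatives of the case; hence \<open>x >= b + c - z\<close>, which also gives
  \<open>y < x\<close>.\<close>

lemma sum_C2: "sum f C2 = (\<Sum>(x, z)\<in>I2.
      w (b + 2 * c + 1 - 2 * z) (x + max 0 (half_ceil (b + c + z - x)))
    - w (a + b + 2 * c + 1 - x) (2 * x - a - 2 * z + max 0 (half_ceil (b + c + z - x))))"
proof -
  let ?g = "\<lambda>(x, z) y. w (a + 2 * b + 3 * c + 1 - x - y - z) (2 * x + y - z - (a + b + c) + max 0 (half_ceil (b + c + z - x)))"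
  have "sum f C2 = (\<Sum>p\<in>I2. ?g p ((\<lambda>(x, z). a + b + c - x + z) p) - ?g p ((\<lambda>(x, z). b + c - z) p))"
  proof (rule sum_fibres_telescope[where base = "\<lambda>(x, y, z). (x, z)" and pos = "\<lambda>(x, y, z). y" and mk = "\<lambda>(x, z) y. (x, y, z)"])
    show "finite I2" by (rule finite_I2)
  next
    fix l assume l: "l \<in> C2"
    obtain x y z where xyz: "l = (x, y, z)" by (cases l) auto
    show "f l = ?g (case l of (x, y, z) \<Rightarrow> (x, z)) (case l of (x, y, z) \<Rightarrow> y) -
      ?g (case l of (x, y, z) \<Rightarrow> (x, z)) ((case l of (x, y, z) \<Rightarrow> y) + 1)"
      using l unfolding xyz by (simp add: f_def stat_C2 area_def algebra_simps)
  qed (use nonneg near in \<open>auto simp: I2_def C2_def subpartitions_def max_def split: if_splits\<close>)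
  then show ?thesis by (simp add: case_prod_unfold algebra_simps)
qed

text \<open>Two inequalities bound \<open>z\<close> from below, hence the maximum; the last value is
  \<open>z = c\<close>. The bound \<open>z <= y\<close> holds since \<open>y >= b >= c - 1\<close>,
  and \<open>y = c - 1\<close> would force \<open>x > a + b + c\<close>.\<close>

lemma sum_C3: "sum f C3 = (\<Sum>(x, y)\<in>I3.
      w (a + 2 * b + 3 * c + 1 - x - y - max (b + c - y) (a + 3 * b + 3 * c - x - 3 * y))
        (2 * x + 3 * y + max (b + c - y) (a + 3 * b + 3 * c - x - 3 * y) - (a + 3 * b + 3 * c) + M x y)
    - w (a + 2 * b + 2 * c - x - y) (2 * x + 3 * y + 1 - (a + 3 * b + 2 * c) + M x y))"
proof -
  let ?g = "\<lambda>(x, y) z. w (a + 2 * b + 3 * c + 1 - x - y - z) (2 * x + 3 * y + z - (a + 3 * b + 3 * c) + M x y)"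
  have "sum f C3 = (\<Sum>p\<in>I3. ?g p ((\<lambda>(x, y). max (b + c - y) (a + 3 * b + 3 * c - x - 3 * y)) p) - ?g p ((\<lambda>_. c + 1) p))"
  proof (rule sum_fibres_telescope[where base = "\<lambda>(x, y, z). (x, y)" and pos = "\<lambda>(x, y, z). z" and mk = "\<lambda>(x, y) z. (x, y, z)"])
    show "finite I3" by (rule finite_I3)
  next
    fix l assume l: "l \<in> C3"
    obtain x y z where xyz: "l = (x, y, z)" by (cases l) auto
    show "f l = ?g (case l of (x, y, z) \<Rightarrow> (x, y)) (case l of (x, y, z) \<Rightarrow> z) -
      ?g (case l of (x, y, z) \<Rightarrow> (x, y)) ((case l of (x, y, z) \<Rightarrow> z) + 1)"
      using l unfolding xyz by (simp add: f_def stat_C3 area_def algebra_simps)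
  qed (use nonneg near in \<open>auto simp: I3_def C3_def subpartitions_def max_def split: if_splits\<close>)
  then show ?thesis by (simp add: case_prod_unfold algebra_simps)
qed

text \<open>Here \<open>y\<close> runs from \<open>a + 2 * z + 1\<close> to \<open>x\<close>. The
  bounds in \<open>I4\<close> give \<open>3 * z < b + c - a\<close>, so \<open>z <= c\<close>
  follows from \<open>near\<close>.\<close>

lemma sum_C4: "sum f C4 = (\<Sum>(x, z)\<in>I4. w (2 * b + 3 * c - x - 3 * z) (a + 1 + 3 * z)
    - w (a + 2 * b + 3 * c - 2 * x - z) (x + 1 + z))"
proof -
  let ?g = "\<lambda>(x, z) y. w (a + 2 * b + 3 * c + 1 - x - y - z) (y + z)"
  have "sum f C4 = (\<Sum>p\<in>I4. ?g p ((\<lambda>(x, z). a + 2 * z + 1) p) - ?g p ((\<lambda>(x, z). x + 1) p))"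
  proof (rule sum_fibres_telescope[where base = "\<lambda>(x, y, z). (x, z)" and pos = "\<lambda>(x, y, z). y" and mk = "\<lambda>(x, z) y. (x, y, z)"])
    show "finite I4" by (rule finite_I4)
  next
    fix l assume l: "l \<in> C4"
    obtain x y z where xyz: "l = (x, y, z)" by (cases l) auto
    show "f l = ?g (case l of (x, y, z) \<Rightarrow> (x, z)) (case l of (x, y, z) \<Rightarrow> y) -
      ?g (case l of (x, y, z) \<Rightarrow> (x, z)) ((case l of (x, y, z) \<Rightarrow> y) + 1)"
      using l unfolding xyz by (simp add: f_def stat_C4 area_def algebra_simps)
  qed (use nonneg near in \<open>auto simp: I4_def C4_def subpartitions_def max_def split: if_splits\<close>)
  then show ?thesis by (simp add: case_prod_unfold algebra_simps)
qed

section \<open>Comparison of the chain ends\<close>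

lemma sum_split:
  "finite S \<Longrightarrow> sum h S = sum h {(x, y)\<in>S. R x y} + sum h {(x, y)\<in>S. \<not> R x y}"
  for h :: "'b \<times> 'c \<Rightarrow> 'a"
  by (subst sum.union_disjoint[symmetric]) (auto intro: sum.cong finite_subset[of _ S])

text \<open>A chain crosses the border here: for \<open>x = X y z\<close> the first point of the
  segment of \<open>C2\<close> over \<open>(x, z)\<close> has this very \<open>y\<close>. For
  \<open>y + z < b + c\<close> the last entry of \<open>E\<close> is at most the one with
  \<open>y - a\<close>, and \<open>b + c + z - x = y - a\<close> identifies the two maxima.\<close>

lemma ends_C1_C2:
  "(\<Sum>(y, z)\<in>{(y, z)\<in>I1. y + z < b + c}. w (a + 2 * b + 3 * c + 1 - X y z - y - z) (X y z + E y z)) =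
   (\<Sum>(x, z)\<in>I2. w (b + 2 * c + 1 - 2 * z) (x + max 0 (half_ceil (b + c + z - x))))"
proof (rule sum.reindex_bij_witness[of _ "\<lambda>(x, z). (a + b + c - x + z, z)" "\<lambda>(y, z). (X y z, z)"], goal_cases)
  case (5 p)
  obtain y z where p: "p = (y, z)" by (cases p)
  have v: "y + z < b + c" using 5 p by auto
  have E: "E y z = max 0 (half_ceil (y - a))"
    using v half_ceil_le_iff[of "2 * y + z - (a + b + c)" "max 0 (half_ceil (y - a))"]
      half_ceil_bounds[of "y - a"]
    unfolding E_def by auto
  have X: "X y z = a + b + c - y + z" using v by (auto simp: X_def)
  have eq: "b + c + z - (a + b + c - y + z) = y - a" by simp
  show ?case unfolding p prod.case E X eq by (simp add: algebra_simps)
qed (use nonneg near in \<open>auto simp: I1_def I2_def X_def box_def max_def split: if_splits\<close>)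

text \<open>For \<open>y + z >= b + c\<close> the chain passes from \<open>C1\<close> directly into
  \<open>C3\<close>. The condition on \<open>I3\<close> says that the second lower bound on
  \<open>z\<close> is the effective one.\<close>

lemma ends_C1_C3:
  "(\<Sum>(y, z)\<in>{(y, z)\<in>I1. \<not> y + z < b + c}. w (a + 2 * b + 3 * c + 1 - X y z - y - z) (X y z + E y z)) =
   (\<Sum>(x, y)\<in>{(x, y)\<in>I3. \<not> x + 2 * y > a + 2 * b + 2 * c}.
      w (a + 2 * b + 3 * c + 1 - x - y - max (b + c - y) (a + 3 * b + 3 * c - x - 3 * y))
        (2 * x + 3 * y + max (b + c - y) (a + 3 * b + 3 * c - x - 3 * y) - (a + 3 * b + 3 * c) + M x y))"
proof (rule sum.reindex_bij_witness[of _ "\<lambda>(x, y). (y, a + 3 * b + 3 * c - x - 3 * y)" "\<lambda>(y, z). (X y z, y)"], goal_cases)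
  case (5 p)
  obtain y z where p: "p = (y, z)" by (cases p)
  have v: "y + z \<ge> b + c" using 5 p by auto
  then have X: "X y z = a + 3 * b + 3 * c - 3 * y - z" by (simp add: X_def)
  have eq: "2 * b + 2 * c - X y z - y = 2 * y + z - (a + b + c)" "a + 2 * b + 2 * c - X y z - 2 * y = y + z - b - c"
    using X by auto
  have "half_ceil (y - a) \<le> half_ceil (2 * y + z - (a + b + c))"
    using v half_ceil_bounds[of "2 * y + z - (a + b + c)"] by (simp add: half_ceil_le_iff)
  then have EM: "E y z = M (X y z) y" unfolding E_def M_def eq by auto
  have mx: "max (b + c - y) (a + 3 * b + 3 * c - X y z - 3 * y) = z" using X v by auto
  show ?case unfolding p prod.case EM mx unfolding X by (simp add: algebra_simps)
qed (use nonneg near in \<open>auto simp: I1_def I3_def X_def box_def max_def split: if_splits\<close>)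

text \<open>The remaining lower ends of \<open>C3\<close> lie at \<open>z = b + c - y\<close>, the
  border at which the segments of \<open>C2\<close> stop.\<close>

lemma ends_C2_C3:
  "(\<Sum>(x, z)\<in>I2. w (a + b + 2 * c + 1 - x) (2 * x - a - 2 * z + max 0 (half_ceil (b + c + z - x)))) =
   (\<Sum>(x, y)\<in>{(x, y)\<in>I3. x + 2 * y > a + 2 * b + 2 * c}.
      w (a + 2 * b + 3 * c + 1 - x - y - max (b + c - y) (a + 3 * b + 3 * c - x - 3 * y))
        (2 * x + 3 * y + max (b + c - y) (a + 3 * b + 3 * c - x - 3 * y) - (a + 3 * b + 3 * c) + M x y))"
proof (rule sum.reindex_bij_witness[of _ "\<lambda>(x, y). (x, b + c - y)" "\<lambda>(x, z). (x, b + c - z)"], goal_cases)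
  case (5 p)
  obtain x z where p: "p = (x, z)" by (cases p)
  have x: "x > a + 2 * z" "x \<ge> b + c - z" using 5 p by (auto simp: I2_def)
  have eq: "2 * b + 2 * c - x - (b + c - z) = b + c + z - x" by simp
  have "M x (b + c - z) = max 0 (half_ceil (b + c + z - x))" unfolding M_def eq using x by auto
  moreover have "max (b + c - (b + c - z)) (a + 3 * b + 3 * c - x - 3 * (b + c - z)) = z" using x by auto
  ultimately show ?case unfolding p by (simp add: algebra_simps)
qed (use nonneg near in \<open>auto simp: I2_def I3_def\<close>)

text \<open>The three border bijections use up all upper ends of \<open>C1\<close> and
  \<open>C2\<close> and all lower ends of \<open>C2\<close> and \<open>C3\<close>.\<close>

lemma sum_f_subpartitions:
  "sum f (subpartitions a b c) =
     (\<Sum>(y, z)\<in>I1. w (a + 2 * b + 3 * c + 1 - 2 * y - z) (y + E y z))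
   + (\<Sum>(x, z)\<in>I4. w (2 * b + 3 * c - x - 3 * z) (a + 1 + 3 * z))
   - (\<Sum>(x, z)\<in>I4. w (a + 2 * b + 3 * c - 2 * x - z) (x + 1 + z))
   - (\<Sum>(x, y)\<in>I3. w (a + 2 * b + 2 * c - x - y) (2 * x + 3 * y + 1 - (a + 3 * b + 2 * c) + M x y))"
proof -
  have "subpartitions a b c = C1 \<union> C2 \<union> C3 \<union> C4"
    by (auto simp: C1_def C2_def C3_def C4_def)
  moreover have "finite C1" "finite C2" "finite C3" "finite C4"
    by (auto intro!: finite_subset[OF _ finite_subpartitions] simp: C1_def C2_def C3_def C4_def)
  moreover have "C1 \<inter> C2 = {}" "(C1 \<union> C2) \<inter> C3 = {}" "(C1 \<union> C2 \<union> C3) \<inter> C4 = {}"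
    by (auto simp: C1_def C2_def C3_def C4_def)
  ultimately have *: "sum f (subpartitions a b c) = sum f C1 + sum f C2 + sum f C3 + sum f C4"
    by (simp add: sum.union_disjoint)
  note I1 = sum_split[OF finite_I1, where R = "\<lambda>y z. y + z < b + c"]
  note I3 = sum_split[OF finite_I3, where R = "\<lambda>x y. x + 2 * y > a + 2 * b + 2 * c"]
  have s: "(\<Sum>(x, y)\<in>S. g x y - h x y) = (\<Sum>(x, y)\<in>S. g x y) - (\<Sum>(x, y)\<in>S. h x y)" for S :: "(int \<times> int) set" and g h :: "int \<Rightarrow> int \<Rightarrow> 'a"
    by (simp add: case_prod_unfold sum_subtractf)
  show ?thesis
    unfolding * sum_C1 sum_C2 sum_C3 sum_C4 s
    unfolding I1[of "\<lambda>(y, z). w (a + 2 * b + 3 * c + 1 - X y z - y - z) (X y z + E y z)"]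
      I3[of "\<lambda>(x, y). w (a + 2 * b + 3 * c + 1 - x - y - max (b + c - y) (a + 3 * b + 3 * c - x - 3 * y))
        (2 * x + 3 * y + max (b + c - y) (a + 3 * b + 3 * c - x - 3 * y) - (a + 3 * b + 3 * c) + M x y)"]
      ends_C1_C2 ends_C1_C3 ends_C2_C3
    by simp
qed

text \<open>
  The points off the line with \<open>n > a\<close>. Here \<open>y + half_ceil (y - a)\<close> skips exactly the values
  \<open>n\<close> congruent to \<open>a + 1\<close> modulo 3, and these are supplied by the lower ends of \<open>C4\<close>.
\<close>

definition Q where
  "Q = {(s, n). n > a \<and> n > s - b - c \<and> 5 * n \<le> 3 * s - a + 1 \<and> n \<le> b + c}"

lemma finite_Q: "finite Q"
  by (rule finite_int_pairs[of _ "2 * (a + b + c)"]) (use nonneg near in \<open>auto simp: Q_def\<close>)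

abbreviation "u s n \<equiv> w (a + 2 * b + 3 * c + 1 - s) n"

text \<open>For \<open>n - a = 3 * j - 1\<close> or \<open>3 * j\<close> the witness returns
  \<open>y - a = 2 * j - 1\<close> or \<open>2 * j\<close>. The inequality on \<open>3 * s\<close>
  is \<open>y + z < b + c\<close> in these coordinates; on the remaining residue class it expresses
  \<open>x < b + c - z\<close> for \<open>C4\<close>.\<close>

lemma sum_I1_below:
  "(\<Sum>(y, z)\<in>{(y, z)\<in>I1. y + z < b + c \<and> y > a}. w (a + 2 * b + 3 * c + 1 - 2 * y - z) (y + E y z)) =
   (\<Sum>(s, n)\<in>{(s, n)\<in>Q. 3 * s < 2 * n + a + 3 * b + 3 * c - 1 \<and> (n - a) mod 3 \<noteq> 1}. u s n)"
proof (rule sum.reindex_bij_witness[of _ "\<lambda>(s, n). let y = a + (2 * (n - a)) div 3 in (y, s - 2 * y)"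
      "\<lambda>(y, z). (2 * y + z, y + half_ceil (y - a))"], goal_cases)
  case (1 p)
  obtain y z where p: "p = (y, z)" by (cases p)
  obtain j where "half_ceil (y - a) = j" "y = a + 2 * j - 1 \<or> y = a + 2 * j"
    using half_ceil_bounds[of "y - a"] by force
  moreover from this(2) have "(2 * (y + j - a)) div 3 = y - a" by presburger
  ultimately show ?case unfolding p by (simp add: Let_def)
next
  case (2 p)
  obtain y z where p: "p = (y, z)" by (cases p)
  obtain j where j: "half_ceil (y - a) = j" "y = a + 2 * j - 1 \<or> y = a + 2 * j"
    using half_ceil_bounds[of "y - a"] by force
  have "(y + j - a) mod 3 \<noteq> 1" using j(2) by presburger
  then show ?case using 2 nonneg near j(2) unfolding p
    by (auto simp: I1_def Q_def box_def max_def j(1) split: if_splits)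
next
  case (3 p)
  obtain s n where p: "p = (s, n)" by (cases p)
  have "(n - a) mod 3 \<noteq> 1" using 3 unfolding p by simp
  then have "n = a + 3 * ((n - a + 1) div 3) - 1 \<or> n = a + 3 * ((n - a + 1) div 3)" by presburger
  then obtain j where "n = a + 3 * j - 1 \<or> n = a + 3 * j" by blast
  then consider "n = a + 3 * j - 1" "(2 * (n - a)) div 3 = 2 * j - 1" | "n = a + 3 * j" "(2 * (n - a)) div 3 = 2 * j"
    by fastforce
  then show ?case
  proof cases
    case 1
    then have "half_ceil (2 * j - 1) = j" using half_ceil_bounds[of "2 * j - 1"] by auto
    then show ?thesis using 1 unfolding p by (simp add: Let_def)
  next
    case 2
    then have "half_ceil (2 * j) = j" using half_ceil_bounds[of "2 * j"] by auto
    then show ?thesis using 2 unfolding p by (simp add: Let_def)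
  qed
next
  case (4 p)
  obtain s n where p: "p = (s, n)" by (cases p)
  have "(n - a) mod 3 \<noteq> 1" using 4 unfolding p by simp
  then have "n = a + 3 * ((n - a + 1) div 3) - 1 \<or> n = a + 3 * ((n - a + 1) div 3)" by presburger
  then obtain j where j: "n = a + 3 * j - 1 \<or> n = a + 3 * j" by blast
  from j consider "n = a + 3 * j - 1" "(2 * (n - a)) div 3 = 2 * j - 1" | "n = a + 3 * j" "(2 * (n - a)) div 3 = 2 * j"
    by fastforce
  moreover have "n > a" using 4 unfolding p by (auto simp: Q_def)
  then have "j \<ge> 1" using j by linarith
  ultimately show ?case using 4 nonneg near unfolding p
    by cases (auto simp: Let_def I1_def Q_def box_def max_def split: if_splits)
next
  case (5 p)
  obtain y z where p: "p = (y, z)" by (cases p)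
  have "half_ceil (2 * y + z - (a + b + c)) \<le> half_ceil (y - a)" "half_ceil (y - a) \<ge> 1"
    using 5 half_ceil_bounds[of "y - a"] unfolding p by (auto simp: half_ceil_le_iff)
  then have "E y z = half_ceil (y - a)" using 5 unfolding p E_def by auto
  then show ?case unfolding p by (simp add: algebra_simps)
qed

text \<open>Here \<open>0 <= y + z - b - c < y - a\<close>, so \<open>E\<close> takes its last
  entry. This depends on \<open>s = 2 * y + z\<close> only, hence \<open>y\<close> is recovered from
  \<open>n\<close> by subtraction.\<close>

lemma sum_I1_above:
  "(\<Sum>(y, z)\<in>{(y, z)\<in>I1. y + z \<ge> b + c \<and> z < b + c - a}. w (a + 2 * b + 3 * c + 1 - 2 * y - z) (y + E y z)) =
   (\<Sum>(s, n)\<in>{(s, n)\<in>Q. \<not> 3 * s < 2 * n + a + 3 * b + 3 * c - 1}. u s n)"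
proof (rule sum.reindex_bij_witness[of _ "\<lambda>(s, n). let y = n - half_ceil (s - (a + b + c)) in (y, s - 2 * y)"
      "\<lambda>(y, z). (2 * y + z, y + half_ceil (2 * y + z - (a + b + c)))"], goal_cases)
  case (2 p)
  obtain y z where p: "p = (y, z)" by (cases p)
  define h where "h = half_ceil (2 * y + z - (a + b + c))"
  have "2 * y + z - (a + b + c) \<le> 2 * h" "2 * h \<le> 2 * y + z - (a + b + c) + 1"
    using half_ceil_bounds[of "2 * y + z - (a + b + c)"] by (simp_all add: h_def)
  \<comment> \<open>Rounding up happens only for an odd argument, and then parity excludes equality
    in \<open>4 * y + z <= a + 3 * b + 3 * c\<close>. The unit gained pays for the rounding in the
    bound on \<open>5 * n\<close>.\<close>
  then have "2 * h = 2 * y + z - (a + b + c) \<or> 2 * h = 2 * y + z - (a + b + c) + 1 \<and> 4 * y + z \<noteq> a + 3 * b + 3 * c"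
    by presburger
  then consider "2 * h = 2 * y + z - (a + b + c)" | "2 * h = 2 * y + z - (a + b + c) + 1" "4 * y + z \<noteq> a + 3 * b + 3 * c"
    by blast
  moreover have "4 * y + z \<le> a + 3 * b + 3 * c" "b + c \<le> y + z"
    using 2 unfolding p by (auto simp: I1_def)
  ultimately have "5 * half_ceil (2 * y + z - (a + b + c)) \<le> y + 3 * z + 1 - a"
    unfolding h_def[symmetric] by cases linarith+
  then show ?case using 2 nonneg near half_ceil_bounds[of "2 * y + z - (a + b + c)"] unfolding p
    by (auto simp: I1_def Q_def box_def max_def split: if_splits)
next
  case (4 p)
  obtain s n where p: "p = (s, n)" by (cases p)
  show ?case using 4 nonneg near half_ceil_bounds[of "s - (a + b + c)"] unfolding p
    by (auto simp: Let_def I1_def Q_def box_def max_def split: if_splits)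
next
  case (5 p)
  obtain y z where p: "p = (y, z)" by (cases p)
  have "half_ceil (y - a) \<le> half_ceil (2 * y + z - (a + b + c))" "y + z - b - c \<le> half_ceil (2 * y + z - (a + b + c))"
    using 5 half_ceil_bounds[of "2 * y + z - (a + b + c)"] unfolding p by (auto simp: half_ceil_le_iff)
  then have "E y z = half_ceil (2 * y + z - (a + b + c))" using 5 unfolding p E_def by auto
  then show ?case unfolding p by (simp add: algebra_simps)
qed (auto simp: Let_def)

lemma sum_I4_bottom:
  "(\<Sum>(x, z)\<in>I4. w (2 * b + 3 * c - x - 3 * z) (a + 1 + 3 * z)) =
   (\<Sum>(s, n)\<in>{(s, n)\<in>Q. 3 * s < 2 * n + a + 3 * b + 3 * c - 1 \<and> (n - a) mod 3 = 1}. u s n)"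
proof (rule sum.reindex_bij_witness[of _ "\<lambda>(s, n). (s - n, (n - a - 1) div 3)" "\<lambda>(x, z). (x + a + 1 + 3 * z, a + 1 + 3 * z)"], goal_cases)
  case (2 p)
  then show ?case by (cases p) (auto simp: I4_def Q_def mod_eq_dvd_iff)
next
  case (3 p)
  then show ?case by (cases p) (auto; presburger)
next
  case (4 p)
  obtain s n where p: "p = (s, n)" by (cases p)
  have "(n - a) mod 3 = 1" using 4 unfolding p by simp
  then have "n = a + 1 + 3 * ((n - a - 1) div 3)" by presburger
  then obtain j where "n = a + 1 + 3 * j" by blast
  then show ?case using 4 nonneg near unfolding p by (auto simp: I4_def Q_def)
qed (auto simp: algebra_simps)

text \<open>\<open>Q\<close> is modelled on these ends: \<open>x > a + 2 * z\<close> reads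
  \<open>5 * n <= 3 * s - a + 1\<close>, \<open>x < b + c - z\<close> reads
  \<open>n <= b + c\<close>, and \<open>z >= 0\<close> reads \<open>2 * n > s\<close>.\<close>

lemma sum_I4_top:
  "(\<Sum>(x, z)\<in>I4. w (a + 2 * b + 3 * c - 2 * x - z) (x + 1 + z)) = (\<Sum>(s, n)\<in>{(s, n)\<in>Q. 2 * n > s}. u s n)"
  by (rule sum.reindex_bij_witness[of _ "\<lambda>(s, n). (s - n, 2 * n - s - 1)" "\<lambda>(x, z). (2 * x + z + 1, x + z + 1)"])
    (use nonneg near in \<open>auto simp: I4_def Q_def algebra_simps\<close>)

lemma sum_box_below:
  "(\<Sum>(y, z)\<in>{(y, z)\<in>box. y + z < b + c \<and> y > a}. w (a + 2 * b + 3 * c + 1 - 2 * y - z) y) =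
   (\<Sum>(s, n)\<in>{(s, n)\<in>Q. \<not> 2 * n > s}. u s n)"
  by (rule sum.reindex_bij_witness[of _ "\<lambda>(s, n). (n, s - 2 * n)" "\<lambda>(y, z). (2 * y + z, y)"])
    (use nonneg near in \<open>auto simp: box_def Q_def algebra_simps\<close>)

text \<open>Two decompositions of \<open>Q\<close> are compared: lower ends of \<open>C1\<close> and
  \<open>C4\<close> on one side, upper ends of \<open>C4\<close> and bracket terms with
  \<open>y > a\<close> on the other. For \<open>y <= a\<close> and \<open>y + z < b + c\<close> the
  entry \<open>E y z\<close> vanishes and the terms agree.\<close>

lemma ends_offline:
  "(\<Sum>(y, z)\<in>{(y, z)\<in>I1. \<not> (y + z \<ge> b + c \<and> z \<ge> b + c - a)}. w (a + 2 * b + 3 * c + 1 - 2 * y - z) (y + E y z))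
   + (\<Sum>(x, z)\<in>I4. w (2 * b + 3 * c - x - 3 * z) (a + 1 + 3 * z))
   - (\<Sum>(x, z)\<in>I4. w (a + 2 * b + 3 * c - 2 * x - z) (x + 1 + z)) =
   (\<Sum>(y, z)\<in>{(y, z)\<in>box. y + z < b + c}. w (a + 2 * b + 3 * c + 1 - 2 * y - z) y)"
proof -
  define g where "g = (\<lambda>(y, z). w (a + 2 * b + 3 * c + 1 - 2 * y - z) (y + E y z))"
  define h where "h = (\<lambda>(y, z). w (a + 2 * b + 3 * c + 1 - 2 * y - z) y)"
  define v where "v = (\<lambda>(s, n). u s n)"
  let ?N = "{(y, z)\<in>I1. \<not> (y + z \<ge> b + c \<and> z \<ge> b + c - a)}"
  let ?A = "{(y, z)\<in>I1. y + z < b + c \<and> y \<le> a}"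
  let ?B = "{(y, z)\<in>I1. y + z < b + c \<and> y > a}"
  let ?C = "{(y, z)\<in>I1. y + z \<ge> b + c \<and> z < b + c - a}"
  let ?A' = "{(y, z)\<in>box. y + z < b + c \<and> y \<le> a}"
  let ?B' = "{(y, z)\<in>box. y + z < b + c \<and> y > a}"
  have fin: "finite ?A" "finite ?B" "finite ?C" "finite ?A'" "finite ?B'"
    by (auto intro: finite_subset[OF _ finite_box] simp: I1_def)
  have "?N = ?A \<union> ?B \<union> ?C" "?A \<inter> ?B = {}" "(?A \<union> ?B) \<inter> ?C = {}" by auto
  then have 1: "sum g ?N = sum g ?A + sum g ?B + sum g ?C" using fin by (simp only: sum.union_disjoint finite_UnI)
  have "{(y, z)\<in>box. y + z < b + c} = ?A' \<union> ?B'" "?A' \<inter> ?B' = {}" by auto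
  then have 2: "sum h {(y, z)\<in>box. y + z < b + c} = sum h ?A' + sum h ?B'" using fin by (simp only: sum.union_disjoint)
  have 3: "sum g ?A = sum h ?A'"
  proof (rule sum.cong)
    show "?A = ?A'" using nonneg by (auto simp: I1_def box_def max_def)
    fix p assume "p \<in> ?A'"
    then obtain y z where p: "p = (y, z)" "y + z < b + c" "y \<le> a" by auto
    have "half_ceil (y - a) \<le> 0" "half_ceil (2 * y + z - (a + b + c)) \<le> 0" using p nonneg by (auto simp: half_ceil_le_iff)
    then have "E y z = 0" using p unfolding E_def by auto
    then show "g p = h p" unfolding p by (simp add: g_def h_def)
  qed
  let ?q3 = "\<lambda>s n. 3 * s < 2 * n + a + 3 * b + 3 * c - 1"
  have f: "finite {(s, n)\<in>Q. ?q3 s n}" by (auto intro: finite_subset[OF _ finite_Q])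
  have 4: "sum v Q = sum v {(s, n)\<in>Q. ?q3 s n \<and> (n - a) mod 3 \<noteq> 1} + sum v {(s, n)\<in>Q. ?q3 s n \<and> (n - a) mod 3 = 1}
      + sum v {(s, n)\<in>Q. \<not> ?q3 s n}"
    using sum_split[OF finite_Q, of v ?q3] sum_split[OF f, of v "\<lambda>s n. (n - a) mod 3 \<noteq> 1"]
    by (simp add: case_prod_unfold conj_assoc)
  have 5: "sum v Q = sum v {(s, n)\<in>Q. 2 * n > s} + sum v {(s, n)\<in>Q. \<not> 2 * n > s}"
    by (rule sum_split[OF finite_Q])
  show ?thesis
    unfolding sum_I4_bottom sum_I4_top
    using 1 2 3 4 5 sum_I1_below sum_I1_above sum_box_below
    unfolding g_def[symmetric] h_def[symmetric] v_def[symmetric] by (simp add: algebra_simps)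
qed

text \<open>The outer maximum equals \<open>n\<close> exactly when the exponent pair lies on the
  image of the line \<open>n = s - b - c\<close> under the exchange of the two exponents.\<close>

lemma top_C3_index:
  "w (a + 2 * b + 2 * c - x - y) (2 * x + 3 * y + 1 - (a + 3 * b + 2 * c) + M x y) =
   w n (a + b + 2 * c + 1 - 2 * n + max n (max y (y + half_ceil (n - a))))" if "n = a + 2 * b + 2 * c - x - y"
proof -
  have eq: "2 * b + 2 * c - x - y = n - a" "a + 2 * b + 2 * c - x - 2 * y = n - y" using that by auto
  have "M x y = max n (max y (y + half_ceil (n - a))) - y" unfolding M_def eq by auto
  then have "2 * x + 3 * y + 1 - (a + 3 * b + 2 * c) + M x y = a + b + 2 * c + 1 - 2 * n + max n (max y (y + half_ceil (n - a)))"
    using that by linarith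
  then show ?thesis by (simp only: that[symmetric])
qed

text \<open>With \<open>k\<close> the maximum of \<open>y\<close> and
  \<open>y + half_ceil (n - a)\<close>, the end becomes the exchanged bracket term at
  \<open>(n, b + c - k)\<close>, and \<open>k > n\<close> says that the sum of these coordinates is
  below \<open>b + c\<close>.\<close>

lemma tops_offline:
  "(\<Sum>(x, y)\<in>{(x, y)\<in>I3. max y (y + half_ceil (a + 2 * b + 2 * c - x - y - a)) > a + 2 * b + 2 * c - x - y}.
      w (a + 2 * b + 2 * c - x - y) (2 * x + 3 * y + 1 - (a + 3 * b + 2 * c) + M x y)) =
   (\<Sum>(y, z)\<in>{(y, z)\<in>box. y + z < b + c}. w y (a + 2 * b + 3 * c + 1 - 2 * y - z))"
proof (rule sum.reindex_bij_witness[of _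
      "\<lambda>(n, z). let y = b + c - z - max 0 (half_ceil (n - a)) in (a + 2 * b + 2 * c - n - y, y)"
      "\<lambda>(x, y). let n = a + 2 * b + 2 * c - x - y in (n, b + c - max y (y + half_ceil (n - a)))"], goal_cases)
  case (1 p)
  then show ?case by (cases p) (auto simp: Let_def max_def)
next
  case (2 p)
  obtain x y where p: "p = (x, y)" by (cases p)
  show ?case using 2 nonneg near half_ceil_bounds[of "a + 2 * b + 2 * c - x - y - a"] unfolding p
    by (auto simp: Let_def I3_def box_def max_def split: if_splits)
next
  case (3 p)
  then show ?case by (cases p) (auto simp: Let_def max_def)
next
  case (4 p)
  obtain n z where p: "p = (n, z)" by (cases p)
  show ?case using 4 nonneg near half_ceil_bounds[of "n - a"] unfolding p
    by (auto simp: Let_def I3_def box_def max_def split: if_splits)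
next
  case (5 p)
  obtain x y where p: "p = (x, y)" by (cases p)
  define n where "n = a + 2 * b + 2 * c - x - y"
  define k where "k = max y (y + half_ceil (n - a))"
  have "k > n" using 5 unfolding p k_def n_def by simp
  then have "w n (2 * x + 3 * y + 1 - (a + 3 * b + 2 * c) + M x y) = w n (a + b + 2 * c + 1 - 2 * n + k)"
    using top_C3_index[OF n_def] unfolding k_def[symmetric] n_def[symmetric] by simp
  then show ?case unfolding p prod.case Let_def n_def[symmetric] k_def[symmetric] by (simp add: algebra_simps)
qed

text \<open>In the new coordinates \<open>y <= n\<close> reads \<open>y + z >= b + c\<close>,
  \<open>y + half_ceil (n - a) <= n\<close> reads \<open>z >= b + c - a\<close>, and
  \<open>x >= y\<close> becomes the last condition of \<open>I1\<close>.\<close>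

lemma tops_online:
  "(\<Sum>(x, y)\<in>{(x, y)\<in>I3. \<not> max y (y + half_ceil (a + 2 * b + 2 * c - x - y - a)) > a + 2 * b + 2 * c - x - y}.
      w (a + 2 * b + 2 * c - x - y) (2 * x + 3 * y + 1 - (a + 3 * b + 2 * c) + M x y)) =
   (\<Sum>(y, z)\<in>{(y, z)\<in>I1. y + z \<ge> b + c \<and> z \<ge> b + c - a}. w (2 * y + z - b - c) (a + 2 * b + 3 * c + 1 - 2 * y - z))"
proof (rule sum.reindex_bij_witness[of _
      "\<lambda>(y, z). (a + 3 * b + 3 * c - 3 * y - z, y)" "\<lambda>(x, y). (y, a + 3 * b + 3 * c - x - 3 * y)"], goal_cases)
  case (2 p)
  obtain x y where p: "p = (x, y)" by (cases p)
  show ?case using 2 nonneg near half_ceil_bounds[of "a + 2 * b + 2 * c - x - y - a"] unfolding p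
    by (auto simp: I1_def I3_def box_def max_def split: if_splits)
next
  case (4 p)
  obtain y z where p: "p = (y, z)" by (cases p)
  show ?case using 4 nonneg near half_ceil_bounds[of "2 * y + z - b - c - a"] unfolding p
    by (auto simp: I1_def I3_def box_def max_def algebra_simps split: if_splits)
next
  case (5 p)
  obtain x y where p: "p = (x, y)" by (cases p)
  define n where "n = a + 2 * b + 2 * c - x - y"
  define k where "k = max y (y + half_ceil (n - a))"
  have "k \<le> n" using 5 unfolding p k_def n_def by (simp only: mem_Collect_eq prod.case not_less)
  then have "w n (2 * x + 3 * y + 1 - (a + 3 * b + 2 * c) + M x y) = w n (a + b + 2 * c + 1 - n)"
    using top_C3_index[OF n_def] unfolding k_def[symmetric] n_def[symmetric] by (simp add: algebra_simps)
  then show ?case unfolding p prod.case n_def[symmetric] by (simp add: n_def algebra_simps)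
qed auto

text \<open>
  The terms of the bracket sum on the line \<open>n = 2y + z - b - c\<close> that are not ends of chains. In
  the coordinates \<open>n\<close> and \<open>i\<close> of the next lemma the exchange of \<open>q\<close> and \<open>t\<close> replaces \<open>n\<close> by
  \<open>a + b + 2c + 1 - n\<close>.
\<close>

definition D where
  "D = {(y, z)\<in>box. y + z \<ge> b + c \<and> \<not> (z \<ge> b + c - a \<and> 4 * y + z \<le> a + 3 * b + 3 * c)}"

text \<open>The exclusion in \<open>D\<close> amounts to \<open>2 * i < n - a\<close>: this is
  \<open>z < b + c - a\<close> for \<open>n <= b + c\<close> and
  \<open>4 * y + z > a + 3 * b + 3 * c\<close> otherwise, and in each case the other alternative
  implies it. The last bound is \<open>z <= c\<close> for \<open>n > b + c\<close>; for smaller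
  \<open>n\<close> it follows from \<open>2 * i < n - a\<close> and \<open>near\<close>.\<close>

lemma D_iff:
  assumes "n = 2 * y + z - b - c" "i = min n (b + c) - y"
  shows "(y, z) \<in> D \<longleftrightarrow> 0 \<le> i \<and> 2 * i < n - a \<and> 2 * i < b + 2 * c + 1 - n"
proof (cases "n \<le> b + c")
  case True
  then have i: "i = y + z - b - c" using assms by auto
  show ?thesis unfolding D_def box_def mem_Collect_eq prod.case
    using nonneg near assms(1) i True by (intro iffI; elim conjE; intro conjI; linarith)
next
  case False
  then have i: "i = b + c - y" using assms by auto
  show ?thesis unfolding D_def box_def mem_Collect_eq prod.case
    using nonneg near assms(1) i False by (intro iffI; elim conjE; intro conjI; linarith)
qed

lemma sum_D_swap:
  "(\<Sum>(y, z)\<in>D. w (a + 2 * b + 3 * c + 1 - 2 * y - z) (2 * y + z - b - c)) =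
   (\<Sum>(y, z)\<in>D. w (2 * y + z - b - c) (a + 2 * b + 3 * c + 1 - 2 * y - z))"
proof -
  \<comment> \<open>The map keeps \<open>i\<close> and replaces \<open>n\<close> by
    \<open>m\<close>, so that the two upper bounds on \<open>2 * i\<close> in \<open>D_iff\<close>
    trade places. The second component solves \<open>m = 2 * y' + z' - b - c\<close> for
    \<open>z'\<close>.\<close>
  define \<phi> where "\<phi> = (\<lambda>(y, z). let n = 2 * y + z - b - c; m = a + b + 2 * c + 1 - n;
      y' = min m (b + c) - (min n (b + c) - y) in (y', m + b + c - 2 * y'))"
  have "\<phi> p \<in> D" if "p \<in> D" for p
  proof -
    obtain y z where p: "p = (y, z)" by (cases p)
    obtain y' z' where \<phi>: "\<phi> p = (y', z')" by (cases "\<phi> p")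
    define n where "n = 2 * y + z - b - c"
    have "2 * y' + z' - b - c = a + b + 2 * c + 1 - n" "min (a + b + 2 * c + 1 - n) (b + c) - y' = min n (b + c) - y"
      using \<phi> unfolding p \<phi>_def by (auto simp: Let_def n_def)
    then show ?thesis
      using that D_iff[of "a + b + 2 * c + 1 - n" y' z'] D_iff[OF n_def refl] unfolding p \<phi>[unfolded p] by auto
  qed
  then show ?thesis
    by (intro sum.reindex_bij_witness[of _ \<phi> \<phi>]) (auto simp: \<phi>_def Let_def algebra_simps)
qed

theorem sum_f_eq_box:
  "sum f (subpartitions a b c) = (\<Sum>(y, z)\<in>box.
      w (a + 2 * b + 3 * c + 1 - 2 * y - z) (y + max 0 (y + z - b - c))
    - w (y + max 0 (y + z - b - c)) (a + 2 * b + 3 * c + 1 - 2 * y - z))"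
proof -
  let ?A = "a + 2 * b + 3 * c + 1"
  define e where "e = (\<lambda>(y, z). w (?A - 2 * y - z) (y + E y z))"
  define g where "g = (\<lambda>(y, z). w (?A - 2 * y - z) (y + max 0 (y + z - b - c)))"
  define h where "h = (\<lambda>(y, z). w (y + max 0 (y + z - b - c)) (?A - 2 * y - z))"
  define k where "k = (\<lambda>(x, y). w (a + 2 * b + 2 * c - x - y) (2 * x + 3 * y + 1 - (a + 3 * b + 2 * c) + M x y))"
  let ?N = "{(y, z)\<in>I1. \<not> (y + z \<ge> b + c \<and> z \<ge> b + c - a)}"
  let ?O = "{(y, z)\<in>I1. y + z \<ge> b + c \<and> z \<ge> b + c - a}"
  let ?B = "{(y, z)\<in>box. y + z < b + c}"
  note I1 = sum_split[OF finite_I1, where R = "\<lambda>y z. y + z \<ge> b + c \<and> z \<ge> b + c - a" and h = e]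
  note I3 = sum_split[OF finite_I3, where h = k and
      R = "\<lambda>x y. max y (y + half_ceil (a + 2 * b + 2 * c - x - y - a)) > a + 2 * b + 2 * c - x - y"]
  have fin: "finite ?O" "finite ?B" "finite D"
    by (auto intro: finite_subset[OF _ finite_box] simp: I1_def D_def)
  \<comment> \<open>\<open>?B\<close> is off the line \<open>n = s - b - c\<close>,
    \<open>?O\<close> holds the points on it that index lower ends of \<open>C1\<close>, and
    \<open>D\<close> the others, whose brackets cancel in total.\<close>
  have "box = ?B \<union> ?O \<union> D" "?B \<inter> ?O = {}" "(?B \<union> ?O) \<inter> D = {}"
    by (auto simp: D_def I1_def max_def split: if_splits)
  then have box: "sum r box = sum r ?B + sum r ?O + sum r D" for r :: "int \<times> int \<Rightarrow> 'a"
    using fin by (metis (no_types, lifting) finite_UnI sum.union_disjoint)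
  have O: "sum e ?O = sum g ?O"
  proof (rule sum.cong)
    fix p assume "p \<in> ?O"
    then obtain y z where p: "p = (y, z)" "y + z \<ge> b + c" "z \<ge> b + c - a" by auto
    have "half_ceil (y - a) \<le> y + z - b - c" "half_ceil (2 * y + z - (a + b + c)) \<le> y + z - b - c"
      using p by (auto simp: half_ceil_le_iff)
    then have "E y z = max 0 (y + z - b - c)" using p unfolding E_def by auto
    then show "e p = g p" unfolding p by (simp add: e_def g_def)
  qed simp
  have "sum g ?B = (\<Sum>(y, z)\<in>?B. w (?A - 2 * y - z) y)" "sum h ?B = (\<Sum>(y, z)\<in>?B. w y (?A - 2 * y - z))"
    by (auto intro!: sum.cong simp: g_def h_def)
  moreover have "sum h ?O = (\<Sum>(y, z)\<in>?O. w (2 * y + z - b - c) (?A - 2 * y - z))"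
    by (rule sum.cong) (auto simp: h_def algebra_simps)
  moreover have "sum g D = sum h D"
  proof -
    have "sum g D = (\<Sum>(y, z)\<in>D. w (?A - 2 * y - z) (2 * y + z - b - c))"
      "sum h D = (\<Sum>(y, z)\<in>D. w (2 * y + z - b - c) (?A - 2 * y - z))"
      by (rule sum.cong; auto simp: g_def h_def D_def algebra_simps)+
    then show ?thesis using sum_D_swap by simp
  qed
  ultimately have "sum f (subpartitions a b c) = sum g box - sum h box"
    using sum_f_subpartitions ends_offline tops_offline tops_online I1 I3 O
    unfolding box e_def[symmetric] k_def[symmetric] by (simp add: algebra_simps)
  then show ?thesis by (simp add: g_def h_def sum_subtractf[symmetric] case_prod_unfold)
qed

end
end

section \<open>The bracket sum in closed form\<close>

lemma power_int_numeral_mult: "x powi (numeral k * m) = (x powi m) ^ numeral k" for x :: "'a::field"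
  by (metis mult.commute power_int_mult power_int_numeral)

text \<open>The maximum becomes positive at \<open>y = b + c - z + 1\<close>, so a progression of
  ratio t / q^2 is followed by one of ratio t^2 / q^2. The last hypothesis keeps the first range
  from having negative length. The exponent of q omits the common summand
  \<open>a + 1\<close>.\<close>

lemma sum_rows:
  fixes q t :: "'a::field" and b c z :: int
  assumes "q \<noteq> 0" "t \<noteq> 0" "q\<^sup>2 \<noteq> t" "q\<^sup>2 \<noteq> t\<^sup>2" "0 \<le> z" "z \<le> c" "2 * z \<le> b + c + 1"
  shows "(\<Sum>y\<in>{z..b + c}. q powi (2 * b + 3 * c - 2 * y - z) * t powi (y + max 0 (y + z - b - c))) =
    q\<^sup>2 / (q\<^sup>2 - t) * (q powi (2 * b + 3 * c - 3 * z) * t powi z - q powi (c + z - 2) * t powi (b + c - z + 1))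
    + q\<^sup>2 / (q\<^sup>2 - t\<^sup>2) * (q powi (c + z - 2) * t powi (b + c - z + 2) - q powi (c - z - 2) * t powi (b + c + z + 2))"
proof -
  let ?f = "\<lambda>y. q powi (2 * b + 3 * c - 2 * y - z) * t powi (y + max 0 (y + z - b - c))"
  \<comment> \<open>Each antidifference is the summand, with the maximum resolved, divided by one
    minus the ratio.\<close>
  define g where "g y = q\<^sup>2 / (q\<^sup>2 - t) * (q powi (2 * b + 3 * c - 2 * y - z) * t powi y)" for y
  define h where "h y = q\<^sup>2 / (q\<^sup>2 - t\<^sup>2) * (q powi (2 * b + 3 * c - 2 * y - z) * t powi (2 * y + z - b - c))" for y
  have nz: "q\<^sup>2 - t \<noteq> 0" "q\<^sup>2 - t\<^sup>2 \<noteq> 0" using assms by auto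
  have g: "g y - g (y + 1) = q powi (2 * b + 3 * c - 2 * y - z) * t powi y" for y
  proof -
    have "q powi (2 * b + 3 * c - 2 * (y + 1) - z) = q powi (2 * b + 3 * c - 2 * y - z) / q\<^sup>2"
      using assms(1) power_int_diff[of q "2 * b + 3 * c - 2 * y - z" 2] by (simp add: algebra_simps)
    then show ?thesis unfolding g_def using assms nz by (simp add: power_int_add divide_simps) (simp add: algebra_simps)
  qed
  have h: "h y - h (y + 1) = q powi (2 * b + 3 * c - 2 * y - z) * t powi (2 * y + z - b - c)" for y
  proof -
    have "q powi (2 * b + 3 * c - 2 * (y + 1) - z) = q powi (2 * b + 3 * c - 2 * y - z) / q\<^sup>2"
      using assms(1) power_int_diff[of q "2 * b + 3 * c - 2 * y - z" 2] by (simp add: algebra_simps)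
    moreover have "t powi (2 * (y + 1) + z - b - c) = t powi (2 * y + z - b - c) * t\<^sup>2"
      using assms(2) power_int_add[of t "2 * y + z - b - c" 2] by (simp add: algebra_simps)
    ultimately show ?thesis unfolding h_def using assms nz by (simp add: divide_simps) (simp add: algebra_simps)
  qed
  have "{z..b + c} = {z..<b + c - z + 1} \<union> {b + c - z + 1..<b + c + 1}" using assms by auto
  then have "sum ?f {z..b + c} = sum ?f {z..<b + c - z + 1} + sum ?f {b + c - z + 1..<b + c + 1}"
    by (simp add: sum.union_disjoint)
  also have "sum ?f {z..<b + c - z + 1} = (\<Sum>y\<in>{z..<b + c - z + 1}. g y - g (y + 1))"
    by (rule sum.cong) (auto simp: g)
  also have "sum ?f {b + c - z + 1..<b + c + 1} = (\<Sum>y\<in>{b + c - z + 1..<b + c + 1}. h y - h (y + 1))"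
    by (rule sum.cong) (auto simp: h algebra_simps)
  also have "(\<Sum>y\<in>{z..<b + c - z + 1}. g y - g (y + 1)) = g z - g (b + c - z + 1)"
    using assms by (intro sum_telescope_int) auto
  also have "(\<Sum>y\<in>{b + c - z + 1..<b + c + 1}. h y - h (y + 1)) = h (b + c - z + 1) - h (b + c + 1)"
    using assms by (intro sum_telescope_int) auto
  also have "g z = q\<^sup>2 / (q\<^sup>2 - t) * (q powi (2 * b + 3 * c - 3 * z) * t powi z)"
    by (simp add: g_def algebra_simps)
  also have "g (b + c - z + 1) = q\<^sup>2 / (q\<^sup>2 - t) * (q powi (c + z - 2) * t powi (b + c - z + 1))"
    by (simp add: g_def algebra_simps)
  also have "h (b + c - z + 1) = q\<^sup>2 / (q\<^sup>2 - t\<^sup>2) * (q powi (c + z - 2) * t powi (b + c - z + 2))"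
    by (simp add: h_def algebra_simps)
  also have "h (b + c + 1) = q\<^sup>2 / (q\<^sup>2 - t\<^sup>2) * (q powi (c - z - 2) * t powi (b + c + z + 2))"
    by (simp add: h_def algebra_simps)
  finally show ?thesis by (simp only: right_diff_distrib)
qed

lemma geometric_powi:
  fixes x y :: "'a::field" and l m n k N :: int
  assumes "x \<noteq> 0" "y \<noteq> 0" "x powi k * y powi n \<noteq> 1" "0 \<le> N"
  shows "(\<Sum>z\<in>{0..N}. x powi (l + k * z) * y powi (m + n * z)) =
    x powi l * y powi m * (1 - (x powi k * y powi n) powi (N + 1)) / (1 - x powi k * y powi n)"
proof -
  let ?r = "x powi k * y powi n"
  have r: "?r \<noteq> 0" "1 - ?r \<noteq> 0" using assms by auto
  have "(\<Sum>z\<in>{0..N}. x powi (l + k * z) * y powi (m + n * z)) =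
    (\<Sum>z\<in>{0..<N + 1}. x powi l * y powi m * ?r powi z / (1 - ?r) - x powi l * y powi m * ?r powi (z + 1) / (1 - ?r))"
  proof (rule sum.cong)
    fix z
    have "x powi (l + k * z) * y powi (m + n * z) = x powi l * y powi m * ?r powi z"
      using assms by (simp add: power_int_add power_int_mult power_int_mult_distrib)
    moreover have "?r powi (z + 1) = ?r powi z * ?r" using power_int_add[of ?r z 1] r(1) by simp
    ultimately show "x powi (l + k * z) * y powi (m + n * z) =
        x powi l * y powi m * ?r powi z / (1 - ?r) - x powi l * y powi m * ?r powi (z + 1) / (1 - ?r)"
      using r(2) by (simp add: divide_simps) (simp add: algebra_simps)
  qed auto
  also have "\<dots> = x powi l * y powi m / (1 - ?r) - x powi l * y powi m * ?r powi (N + 1) / (1 - ?r)"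
    using assms by (subst sum_telescope_int) auto
  finally show ?thesis by (simp add: diff_divide_distrib[symmetric] right_diff_distrib)
qed

text \<open>The five terms belong to the five tableaux with 2 to the right of 1, that is, with
  second content q. Each coefficient is the weight of its tableau multiplied by 1 - t / q.\<close>

lemma sum_box_closed:
  fixes q t :: "'a::field" and b c :: int
  assumes "q \<noteq> 0" "t \<noteq> 0" "q \<noteq> t" "q\<^sup>2 \<noteq> t" "q\<^sup>2 \<noteq> t\<^sup>2" "q ^ 3 \<noteq> t" "0 \<le> c" "c \<le> b + 1"
  shows "(\<Sum>z\<in>{0..c}. \<Sum>y\<in>{z..b + c}. q powi (2 * b + 3 * c - 2 * y - z) * t powi (y + max 0 (y + z - b - c))) =
      1 / ((1 - t / q\<^sup>2) * (1 - t / q ^ 3)) * (q powi b) ^ 2 * (q powi c) ^ 3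
    + 1 / ((1 - t / q\<^sup>2) * (1 - q ^ 3 / t)) * (q powi b) ^ 2 * t powi c
    + (1 - t) / ((1 - t / q) * (1 - q\<^sup>2 / t) * (1 - t\<^sup>2 / q\<^sup>2)) * t powi b * (q powi c)\<^sup>2
    + (1 - q) / ((1 - t / q) * (1 - q / t) * (1 - q\<^sup>2 / t)) * t powi b * (q powi c * t powi c)
    + 1 / ((1 - q / t) * (1 - q\<^sup>2 / t\<^sup>2)) * t powi b * (t powi c)\<^sup>2"
proof -
  have ratios: "q powi (-3) * t powi 1 = t / q ^ 3" "q powi 1 * t powi (-1) = q / t" "q powi (-1) * t powi 1 = t / q"
    using assms by (simp_all add: power_int_def field_simps)
  have ne: "t / q ^ 3 \<noteq> 1" "q / t \<noteq> 1" "t / q \<noteq> 1" using assms by (auto simp: field_simps)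
  note geo = geometric_powi[OF assms(1,2)]
  have "(\<Sum>z\<in>{0..c}. \<Sum>y\<in>{z..b + c}. q powi (2 * b + 3 * c - 2 * y - z) * t powi (y + max 0 (y + z - b - c))) =
    (\<Sum>z\<in>{0..c}. q\<^sup>2 / (q\<^sup>2 - t) * (q powi (2 * b + 3 * c + (-3) * z) * t powi (0 + 1 * z) - q powi (c - 2 + 1 * z) * t powi (b + c + 1 + (-1) * z))
    + q\<^sup>2 / (q\<^sup>2 - t\<^sup>2) * (q powi (c - 2 + 1 * z) * t powi (b + c + 2 + (-1) * z) - q powi (c - 2 + (-1) * z) * t powi (b + c + 2 + 1 * z)))"
    (is "_ = ?S")
  proof (rule sum.cong)
    fix z assume z: "z \<in> {0..c}"
    have e: "2 * b + 3 * c + (-3) * z = 2 * b + 3 * c - 3 * z" "0 + 1 * z = z" "c - 2 + 1 * z = c + z - 2"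
      "b + c + 1 + (-1) * z = b + c - z + 1" "b + c + 2 + (-1) * z = b + c - z + 2" "c - 2 + (-1) * z = c - z - 2"
      "b + c + 2 + 1 * z = b + c + z + 2" by simp_all
    show "(\<Sum>y\<in>{z..b + c}. q powi (2 * b + 3 * c - 2 * y - z) * t powi (y + max 0 (y + z - b - c))) =
      q\<^sup>2 / (q\<^sup>2 - t) * (q powi (2 * b + 3 * c + (-3) * z) * t powi (0 + 1 * z) - q powi (c - 2 + 1 * z) * t powi (b + c + 1 + (-1) * z))
    + q\<^sup>2 / (q\<^sup>2 - t\<^sup>2) * (q powi (c - 2 + 1 * z) * t powi (b + c + 2 + (-1) * z) - q powi (c - 2 + (-1) * z) * t powi (b + c + 2 + 1 * z))"
      unfolding e by (rule sum_rows) (use assms z in auto)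
  qed simp
  also have "?S = q\<^sup>2 / (q\<^sup>2 - t) * (q powi (2 * b + 3 * c) * (1 - (t / q ^ 3) powi (c + 1)) / (1 - t / q ^ 3)
        - q powi (c - 2) * t powi (b + c + 1) * (1 - (q / t) powi (c + 1)) / (1 - q / t))
    + q\<^sup>2 / (q\<^sup>2 - t\<^sup>2) * (q powi (c - 2) * t powi (b + c + 2) * (1 - (q / t) powi (c + 1)) / (1 - q / t)
        - q powi (c - 2) * t powi (b + c + 2) * (1 - (t / q) powi (c + 1)) / (1 - t / q))"
    unfolding sum.distrib sum_subtractf sum_distrib_left[symmetric]
    by (subst geo geo[of 1 "-1"] geo[of "-1" 1], use ne assms ratios in simp, use ne assms ratios in simp)+
       (simp only: ratios power_int_0_right mult_1_right)
  also have "\<dots> =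
      1 / ((1 - t / q\<^sup>2) * (1 - t / q ^ 3)) * (q powi b) ^ 2 * (q powi c) ^ 3
    + 1 / ((1 - t / q\<^sup>2) * (1 - q ^ 3 / t)) * (q powi b) ^ 2 * t powi c
    + (1 - t) / ((1 - t / q) * (1 - q\<^sup>2 / t) * (1 - t\<^sup>2 / q\<^sup>2)) * t powi b * (q powi c)\<^sup>2
    + (1 - q) / ((1 - t / q) * (1 - q / t) * (1 - q\<^sup>2 / t)) * t powi b * (q powi c * t powi c)
    + 1 / ((1 - q / t) * (1 - q\<^sup>2 / t\<^sup>2)) * t powi b * (t powi c)\<^sup>2"
  proof -
    \<comment> \<open>The four powers now act as independent symbols. Comparing the coefficients of
      five monomials leaves the rational identities \<open>k1\<close> to \<open>k5\<close> in q and
      t alone.\<close>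
    define Q R B C where "Q = q powi b" and "R = q powi c" and "B = t powi b" and "C = t powi c"
    have nz: "R \<noteq> 0" "C \<noteq> 0" using assms by (auto simp: R_def C_def)
    have p: "q powi (2 * b + 3 * c) = Q\<^sup>2 * R ^ 3" "q powi (c - 2) = R / q\<^sup>2"
      "t powi (b + c + 1) = B * C * t" "t powi (b + c + 2) = B * C * t\<^sup>2"
      "(t / q ^ 3) powi (c + 1) = C / R ^ 3 * (t / q ^ 3)" "(q / t) powi (c + 1) = R / C * (q / t)"
      "(t / q) powi (c + 1) = C / R * (t / q)"
      using assms
      by (simp_all add: Q_def R_def B_def C_def power_int_add power_int_diff power_int_numeral_mult
        power_int_divide_distrib power_int_power)
    have ne: "q\<^sup>2 - t \<noteq> 0" "q\<^sup>2 - t\<^sup>2 \<noteq> 0" "q ^ 3 - t \<noteq> 0" "q - t \<noteq> 0" "t - q \<noteq> 0" "t - q\<^sup>2 \<noteq> 0" "t - q ^ 3 \<noteq> 0" "t\<^sup>2 - q\<^sup>2 \<noteq> 0"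
      using assms by auto
    define \<alpha> \<beta> \<rho>\<^sub>1 \<rho>\<^sub>2 \<rho>\<^sub>3 where "\<alpha> = q\<^sup>2 / (q\<^sup>2 - t)" and "\<beta> = q\<^sup>2 / (q\<^sup>2 - t\<^sup>2)" and "\<rho>\<^sub>1 = 1 / (1 - t / q ^ 3)"
      and "\<rho>\<^sub>2 = 1 / (1 - q / t)" and "\<rho>\<^sub>3 = 1 / (1 - t / q)"
    have sum1: "\<alpha> * (Q\<^sup>2 * R ^ 3 * (1 - C / R ^ 3 * (t / q ^ 3)) / (1 - t / q ^ 3)
          - R / q\<^sup>2 * (B * C * t) * (1 - R / C * (q / t)) / (1 - q / t))
        + \<beta> * (R / q\<^sup>2 * (B * C * t\<^sup>2) * (1 - R / C * (q / t)) / (1 - q / t)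
          - R / q\<^sup>2 * (B * C * t\<^sup>2) * (1 - C / R * (t / q)) / (1 - t / q)) =
        (\<alpha> * \<rho>\<^sub>1) * Q\<^sup>2 * R ^ 3 + (- \<alpha> * \<rho>\<^sub>1 * t / q ^ 3) * Q\<^sup>2 * C
        + (\<alpha> * \<rho>\<^sub>2 / q - \<beta> * \<rho>\<^sub>2 * t / q) * B * R\<^sup>2
        + (- \<alpha> * \<rho>\<^sub>2 * t / q\<^sup>2 + \<beta> * (\<rho>\<^sub>2 - \<rho>\<^sub>3) * t\<^sup>2 / q\<^sup>2) * B * (R * C)
        + (\<beta> * \<rho>\<^sub>3 * t ^ 3 / q ^ 3) * B * C\<^sup>2"
    proof -
      have r: "x / (1 - t / q ^ 3) = x * \<rho>\<^sub>1" "x / (1 - q / t) = x * \<rho>\<^sub>2" "x / (1 - t / q) = x * \<rho>\<^sub>3" for x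
        by (simp_all add: \<rho>\<^sub>1_def \<rho>\<^sub>2_def \<rho>\<^sub>3_def)
      show ?thesis unfolding r using assms nz
        by (simp add: divide_simps) (simp add: algebra_simps eval_nat_numeral)
    qed
    have k1: "\<alpha> * \<rho>\<^sub>1 = 1 / ((1 - t / q\<^sup>2) * (1 - t / q ^ 3))"
      using assms ne by (simp add: \<alpha>_def \<rho>\<^sub>1_def divide_simps)
    have k2: "- \<alpha> * \<rho>\<^sub>1 * t / q ^ 3 = 1 / ((1 - t / q\<^sup>2) * (1 - q ^ 3 / t))"
      using assms ne by (simp add: \<alpha>_def \<rho>\<^sub>1_def divide_simps) (simp add: algebra_simps)
    have k3: "\<alpha> * \<rho>\<^sub>2 / q - \<beta> * \<rho>\<^sub>2 * t / q = (1 - t) / ((1 - t / q) * (1 - q\<^sup>2 / t) * (1 - t\<^sup>2 / q\<^sup>2))"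
      using assms ne by (simp add: \<alpha>_def \<beta>_def \<rho>\<^sub>2_def divide_simps) (simp add: algebra_simps power2_eq_square power3_eq_cube)
    have k4: "- \<alpha> * \<rho>\<^sub>2 * t / q\<^sup>2 + \<beta> * (\<rho>\<^sub>2 - \<rho>\<^sub>3) * t\<^sup>2 / q\<^sup>2 = (1 - q) / ((1 - t / q) * (1 - q / t) * (1 - q\<^sup>2 / t))"
      using assms ne by (simp add: \<alpha>_def \<beta>_def \<rho>\<^sub>2_def \<rho>\<^sub>3_def divide_simps) (simp add: algebra_simps power2_eq_square power3_eq_cube)
    have k5: "\<beta> * \<rho>\<^sub>3 * t ^ 3 / q ^ 3 = 1 / ((1 - q / t) * (1 - q\<^sup>2 / t\<^sup>2))"
      using assms ne by (simp add: \<beta>_def \<rho>\<^sub>3_def divide_simps) (simp add: algebra_simps power2_eq_square power3_eq_cube)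
    show ?thesis
      unfolding p \<alpha>_def[symmetric] \<beta>_def[symmetric] sum1 unfolding k1 k2 k3 k4 k5 Q_def R_def B_def C_def ..
  qed
  finally show ?thesis .
qed

section \<open>The ten tableaux\<close>

lemma q_power_t_power: "q ^ m * t ^ n = Fract (monom (monom 1 m) n) 1"
proof -
  have q: "q ^ m = Fract (monom (monom 1 m) 0) 1"
    by (induction m) (simp_all add: q_def One_fract_def one_pCons monom_0 monom_Suc)
  have t: "t ^ n = Fract (monom 1 n) 1"
    by (induction n) (simp_all add: t_def One_fract_def monom_Suc)
  show ?thesis unfolding q t by (simp add: mult_monom)
qed

lemma q_nonzero [simp]: "q \<noteq> 0" and t_nonzero [simp]: "t \<noteq> 0"
  by (simp_all add: q_def t_def Zero_fract_def eq_fract)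

definition qt_mono :: "int \<Rightarrow> int \<Rightarrow> qt_field" where
  "qt_mono i j = q powi i * t powi j"

lemma qt_power_eq_iff: "q ^ m * t ^ n = q ^ m' * t ^ n' \<longleftrightarrow> m = m' \<and> n = n'"
proof
  assume "q ^ m * t ^ n = q ^ m' * t ^ n'"
  then have "monom (monom (1::rat) m) n = monom (monom 1 m') n'"
    unfolding q_power_t_power by (simp add: eq_fract)
  then show "m = m' \<and> n = n'"
    by (metis degree_monom_eq lead_coeff_monom monom_eq_0_iff one_neq_zero)
qed simp

lemma qt_mono_eq_1_iff: "qt_mono i j = 1 \<longleftrightarrow> i = 0 \<and> j = 0"
proof
  assume 1: "qt_mono i j = 1"
  \<comment> \<open>Writing the exponents as differences of naturals clears denominators and reduces
    to the comparison of polynomials.\<close>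
  obtain m m' n n' :: nat where i: "i = int m - int m'" and j: "j = int n - int n'"
    by (meson int_diff_cases)
  have "q ^ m * t ^ n = q ^ m' * t ^ n'"
    using 1 unfolding qt_mono_def i j by (simp add: power_int_diff divide_simps)
  then have "m = m' \<and> n = n'" by (simp only: qt_power_eq_iff)
  then show "i = 0 \<and> j = 0" by (simp add: i j)
qed (simp add: qt_mono_def)

lemma qt_mono_mult: "qt_mono i j * qt_mono k l = qt_mono (i + k) (j + l)"
  by (simp add: qt_mono_def power_int_add)

lemma qt_mono_divide: "qt_mono i j / qt_mono k l = qt_mono (i - k) (j - l)"
  by (simp add: qt_mono_def power_int_diff)

lemma qt_mono_inverse: "inverse (qt_mono i j) = qt_mono (- i) (- j)"
  by (simp add: qt_mono_def power_int_minus)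

text \<open>By \<open>qt_mono_eq_1_iff\<close> such a factor vanishes only at the exponents (0, 0),
  so omission can be read off the exponents, and every \<open>fac i j\<close> may be
  cancelled.\<close>

definition fac :: "int \<Rightarrow> int \<Rightarrow> qt_field" where
  "fac i j = omit0 (1 - qt_mono i j)"

lemma fac_nonzero [simp]: "fac i j \<noteq> 0"
  by (simp add: fac_def omit0_def)

lemma fac_0_0 [simp]: "fac 0 0 = 1"
  by (simp add: fac_def omit0_def qt_mono_def)

lemma fac_eq: "(i, j) \<noteq> (0, 0) \<Longrightarrow> fac i j = 1 - qt_mono i j"
  using qt_mono_eq_1_iff[of i j] by (auto simp: fac_def omit0_def)

lemma wt_4_mono:
  assumes "\<And>i. i \<in> {1..4} \<Longrightarrow> z i = qt_mono (e i) (f i)"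
  shows "wt 4 z =
    (\<Prod>i\<in>{2,3,4}. 1 / (fac (- e i) (- f i) * fac (1 + e (i - 1) - e i) (1 + f (i - 1) - f i))) *
    (\<Prod>(i, j)\<in>{(1,2),(1,3),(1,4),(2,3),(2,4),(3,4)}.
      fac (e i - e j) (f i - f j) * fac (1 + e i - e j) (1 + f i - f j) /
      (fac (1 + e i - e j) (f i - f j) * fac (e i - e j) (1 + f i - f j)))"
proof -
  have S: "{2..4} = {2,3,4::nat}" "{(i, j). 1 \<le> i \<and> i < j \<and> j \<le> (4::nat)} = {(1,2),(1,3),(1,4),(2,3),(2,4),(3,4)}"
    by auto
  have q: "q = qt_mono 1 0" and t: "t = qt_mono 0 1" by (simp_all add: qt_mono_def)
  show ?thesis unfolding wt_def S q t
    by (rule arg_cong2[where f = "(*)"]; rule prod.cong; use assms in \<open>auto simp: qt_mono_mult qt_mono_divide qt_mono_inverse fac_def\<close>)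
qed

section \<open>Enumeration of the tableaux with four boxes\<close>

definition tab :: "nat \<times> nat \<Rightarrow> nat \<times> nat \<Rightarrow> nat \<times> nat \<Rightarrow> nat \<times> nat \<Rightarrow> nat \<times> nat \<Rightarrow> nat" where
  "tab d1 d2 d3 d4 x = (if x = d1 then 1 else if x = d2 then 2 else if x = d3 then 3 else if x = d4 then 4 else 0)"

lemma tab_inject:
  assumes "distinct [d1, d2, d3, d4]" "tab d1 d2 d3 d4 = tab e1 e2 e3 e4"
  shows "[d1, d2, d3, d4] = [e1, e2, e3, e4]"
  using fun_cong[OF assms(2), of d1] fun_cong[OF assms(2), of d2] fun_cong[OF assms(2), of d3]
    fun_cong[OF assms(2), of d4] assms(1)
  by (simp add: tab_def split: if_splits)

lemma eq_tabI:
  assumes "\<And>x. x \<notin> {d1, d2, d3, d4} \<Longrightarrow> T x = 0" "T d1 = 1" "T d2 = 2" "T d3 = 3" "T d4 = 4"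
  shows "T = tab d1 d2 d3 d4"
  using assms by (auto simp: tab_def fun_eq_iff)

lemma is_partition_4: "is_partition 4 \<mu> \<longleftrightarrow> \<mu> \<in> {[4], [3,1], [2,2], [2,1,1], [1,1,1,1]}"
proof
  assume "is_partition 4 \<mu>"
  then have p: "sorted_wrt (\<ge>) \<mu>" "0 \<notin> set \<mu>" "sum_list \<mu> = 4" by (auto simp: is_partition_def)
  \<comment> \<open>The parts are positive, so five of them would sum to more than 4.\<close>
  consider "\<mu> = []" | x where "\<mu> = [x]" | x y where "\<mu> = [x,y]" | x y z where "\<mu> = [x,y,z]"
    | x y z u where "\<mu> = [x,y,z,u]" | x y z u v xs where "\<mu> = x # y # z # u # v # xs"
    by (metis list.exhaust)
  then show "\<mu> \<in> {[4], [3,1], [2,2], [2,1,1], [1,1,1,1]}"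
    by cases (use p in auto)
qed (auto simp: is_partition_def)

lemma diagram_4:
  "diagram [4] = {(1,1),(1,2),(1,3),(1,4)}"
  "diagram [3,1] = {(1,1),(1,2),(1,3),(2,1)}"
  "diagram [2,2] = {(1,1),(1,2),(2,1),(2,2)}"
  "diagram [2,1,1] = {(1,1),(1,2),(2,1),(3,1)}"
  "diagram [1,1,1,1] = {(1,1),(2,1),(3,1),(4,1)}"
proof -
  have d: "diagram \<mu> = (SIGMA r:{1..length \<mu>}. {1..\<mu> ! (r - 1)})" for \<mu>
    by (auto simp: diagram_def)
  have e: "{Suc 0..2} = {1,2}" "{Suc 0..3} = {1,2,3}" "{Suc 0..4} = {1,2,3,4}"
    "{Suc 0..Suc (Suc 0)} = {1,2}" "{Suc 0..Suc (Suc (Suc 0))} = {1,2,3}" "{Suc 0..Suc (Suc (Suc (Suc 0)))} = {1,2,3,4}"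
    by auto
  show "diagram [4] = {(1,1),(1,2),(1,3),(1,4)}"
    "diagram [3,1] = {(1,1),(1,2),(1,3),(2,1)}"
    "diagram [2,2] = {(1,1),(1,2),(2,1),(2,2)}"
    "diagram [2,1,1] = {(1,1),(1,2),(2,1),(3,1)}"
    "diagram [1,1,1,1] = {(1,1),(2,1),(3,1),(4,1)}"
    unfolding d by (auto simp: e)
qed

text \<open>The three patterns are a single row or column, a hook with corner \<open>x\<close>, long
  arm \<open>y\<close>, \<open>u\<close> and short arm \<open>v\<close>, and the square. The hook
  pattern serves both \<open>[3,1]\<close> and \<open>[2,1,1]\<close>.\<close>

lemma fillings_4:
  fixes x y u v :: nat
  assumes "1 \<le> x" "v \<le> 4"
  shows "x < y \<Longrightarrow> y < u \<Longrightarrow> u < v \<Longrightarrow> x = 1 \<and> y = 2 \<and> u = 3 \<and> v = 4"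
    and "x < y \<Longrightarrow> y < u \<Longrightarrow> u \<le> 4 \<Longrightarrow> x < v \<Longrightarrow> v \<noteq> y \<Longrightarrow> v \<noteq> u \<Longrightarrow>
      x = 1 \<and> (y = 2 \<and> u = 3 \<and> v = 4 \<or> y = 2 \<and> u = 4 \<and> v = 3 \<or> y = 3 \<and> u = 4 \<and> v = 2)"
    and "x < y \<Longrightarrow> x < u \<Longrightarrow> y < v \<Longrightarrow> u < v \<Longrightarrow> y \<noteq> u \<Longrightarrow> x = 1 \<and> v = 4 \<and> (y = 2 \<and> u = 3 \<or> y = 3 \<and> u = 2)"
  using assms by linarith+

lemma tab_in_SYT:
  assumes "is_partition 4 \<mu>" "diagram \<mu> = set [d1, d2, d3, d4]" "distinct [d1, d2, d3, d4]"
    and "\<forall>x\<in>set [d1, d2, d3, d4]. \<forall>y\<in>set [d1, d2, d3, d4].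
      fst x = fst y \<and> snd x < snd y \<or> snd x = snd y \<and> fst x < fst y \<longrightarrow> tab d1 d2 d3 d4 x < tab d1 d2 d3 d4 y"
  shows "(\<mu>, tab d1 d2 d3 d4) \<in> SYT 4"
proof -
  have e: "{1..4} = {1,2,3,4::nat}" by auto
  have "inj_on (tab d1 d2 d3 d4) (diagram \<mu>)"
    unfolding assms(2) using assms(3) by (auto simp: inj_on_def tab_def)
  moreover have "tab d1 d2 d3 d4 ` diagram \<mu> = {1..4}"
  proof -
    have "tab d1 d2 d3 d4 d1 = 1" "tab d1 d2 d3 d4 d2 = 2" "tab d1 d2 d3 d4 d3 = 3" "tab d1 d2 d3 d4 d4 = 4"
      using assms(3) by (auto simp: tab_def)
    then show ?thesis unfolding assms(2) e by simp
  qed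
  ultimately have "bij_betw (tab d1 d2 d3 d4) (diagram \<mu>) {1..4}" by (simp add: bij_betw_def)
  moreover have "tab d1 d2 d3 d4 x = 0" if "x \<notin> diagram \<mu>" for x
    using that unfolding assms(2) by (simp add: tab_def)
  moreover have "tab d1 d2 d3 d4 (r, c) < tab d1 d2 d3 d4 (r, c')"
    if "(r, c) \<in> diagram \<mu>" "(r, c') \<in> diagram \<mu>" "c < c'" for r c c'
    using that assms(4) unfolding assms(2) by (metis fst_conv snd_conv)
  moreover have "tab d1 d2 d3 d4 (r, c) < tab d1 d2 d3 d4 (r', c)"
    if "(r, c) \<in> diagram \<mu>" "(r', c) \<in> diagram \<mu>" "r < r'" for r r' c
    using that assms(4) unfolding assms(2) by (metis fst_conv snd_conv)
  ultimately show ?thesis using assms(1) by (auto simp: SYT_def)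
qed

lemma SYT_4:
  "SYT 4 = {([4], tab (1,1) (1,2) (1,3) (1,4)),
     ([3,1], tab (1,1) (1,2) (1,3) (2,1)), ([3,1], tab (1,1) (1,2) (2,1) (1,3)), ([3,1], tab (1,1) (2,1) (1,2) (1,3)),
     ([2,2], tab (1,1) (1,2) (2,1) (2,2)), ([2,2], tab (1,1) (2,1) (1,2) (2,2)),
     ([2,1,1], tab (1,1) (2,1) (1,2) (3,1)), ([2,1,1], tab (1,1) (1,2) (2,1) (3,1)), ([2,1,1], tab (1,1) (2,1) (3,1) (1,2)),
     ([1,1,1,1], tab (1,1) (2,1) (3,1) (4,1))}" (is "_ = ?R")
proof
  show "SYT 4 \<subseteq> ?R"
  proof
    fix S assume "S \<in> SYT 4"
    obtain \<mu> T where S: "S = (\<mu>, T)" by (cases S)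
    with \<open>S \<in> SYT 4\<close> have \<mu>: "\<mu> \<in> {[4], [3,1], [2,2], [2,1,1], [1,1,1,1]}"
      and bij: "bij_betw T (diagram \<mu>) {1..4}" and out: "\<And>x. x \<notin> diagram \<mu> \<Longrightarrow> T x = 0"
      and row: "\<And>r c c'. (r, c) \<in> diagram \<mu> \<Longrightarrow> (r, c') \<in> diagram \<mu> \<Longrightarrow> c < c' \<Longrightarrow> T (r, c) < T (r, c')"
      and col: "\<And>r r' c. (r, c) \<in> diagram \<mu> \<Longrightarrow> (r', c) \<in> diagram \<mu> \<Longrightarrow> r < r' \<Longrightarrow> T (r, c) < T (r', c)"
      unfolding is_partition_4[symmetric] by (auto simp: SYT_def)
    have rng: "1 \<le> T x" "T x \<le> 4" if "x \<in> diagram \<mu>" for x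
      using bij that by (auto simp: bij_betw_def)
    have inj: "T x \<noteq> T y" if "x \<in> diagram \<mu>" "y \<in> diagram \<mu>" "x \<noteq> y" for x y
      using bij that by (auto simp: bij_betw_def inj_on_def)
    from \<mu> consider "\<mu> = [4]" | "\<mu> = [3,1]" | "\<mu> = [2,2]" | "\<mu> = [2,1,1]" | "\<mu> = [1,1,1,1]" by auto
    then show "S \<in> ?R"
    proof cases
      case 1
      note d = diagram_4(1)[folded 1]
      have "T (1,1) = 1 \<and> T (1,2) = 2 \<and> T (1,3) = 3 \<and> T (1,4) = 4"
        by (rule fillings_4(1); (rule rng row col inj; simp add: d))
      then have "T = tab (1,1) (1,2) (1,3) (1,4)" by (intro eq_tabI out) (auto simp: d)
      then show ?thesis by (simp add: S 1)
    next
      case 2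
      note d = diagram_4(2)[folded 2]
      have "T (1,1) = 1 \<and> (T (1,2) = 2 \<and> T (1,3) = 3 \<and> T (2,1) = 4 \<or>
        T (1,2) = 2 \<and> T (1,3) = 4 \<and> T (2,1) = 3 \<or> T (1,2) = 3 \<and> T (1,3) = 4 \<and> T (2,1) = 2)"
        by (rule fillings_4(2); (rule rng row col inj; simp add: d))
      then have "T = tab (1,1) (1,2) (1,3) (2,1) \<or> T = tab (1,1) (1,2) (2,1) (1,3) \<or> T = tab (1,1) (2,1) (1,2) (1,3)"
        by (elim conjE disjE) (blast intro: eq_tabI out[unfolded d])+
      then show ?thesis by (auto simp: S 2)
    next
      case 3
      note d = diagram_4(3)[folded 3]
      have "T (1,1) = 1 \<and> T (2,2) = 4 \<and> (T (1,2) = 2 \<and> T (2,1) = 3 \<or> T (1,2) = 3 \<and> T (2,1) = 2)"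
        by (rule fillings_4(3); (rule rng row col inj; simp add: d))
      then have "T = tab (1,1) (1,2) (2,1) (2,2) \<or> T = tab (1,1) (2,1) (1,2) (2,2)"
        by (elim conjE disjE) (blast intro: eq_tabI out[unfolded d])+
      then show ?thesis by (auto simp: S 3)
    next
      case 4
      note d = diagram_4(4)[folded 4]
      have "T (1,1) = 1 \<and> (T (2,1) = 2 \<and> T (3,1) = 3 \<and> T (1,2) = 4 \<or>
        T (2,1) = 2 \<and> T (3,1) = 4 \<and> T (1,2) = 3 \<or> T (2,1) = 3 \<and> T (3,1) = 4 \<and> T (1,2) = 2)"
        by (rule fillings_4(2); (rule rng row col inj; simp add: d))
      then have "T = tab (1,1) (2,1) (3,1) (1,2) \<or> T = tab (1,1) (2,1) (1,2) (3,1) \<or> T = tab (1,1) (1,2) (2,1) (3,1)"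
        by (elim conjE disjE) (blast intro: eq_tabI out[unfolded d])+
      then show ?thesis by (auto simp: S 4)
    next
      case 5
      note d = diagram_4(5)[folded 5]
      have "T (1,1) = 1 \<and> T (2,1) = 2 \<and> T (3,1) = 3 \<and> T (4,1) = 4"
        by (rule fillings_4(1); (rule rng row col inj; simp add: d))
      then have "T = tab (1,1) (2,1) (3,1) (4,1)" by (intro eq_tabI out) (auto simp: d)
      then show ?thesis by (simp add: S 5)
    qed
  qed
  show "?R \<subseteq> SYT 4"
    unfolding insert_subset
    by (intro conjI empty_subsetI tab_in_SYT) (auto simp: is_partition_4 diagram_4 tab_def simp del: One_nat_def)
qed

section \<open>Contributions of the ten tableaux\<close>

definition tableau_term :: "int \<Rightarrow> int \<Rightarrow> int \<Rightarrow> (nat list \<times> (nat \<times> nat \<Rightarrow> nat)) \<Rightarrow> qt_field" where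
  "tableau_term a b c S = zval S 2 powi a * zval S 3 powi b * zval S 4 powi c * wt 4 (zval S)"

lemma F_4: "F [a, b, c] = (\<Sum>S\<in>SYT 4. tableau_term a b c S)"
proof -
  have e: "length [a, b, c] + 1 = 4" "{2..4} = {2,3,4::nat}" by auto
  show ?thesis unfolding F_def Let_def e
    by (rule sum.cong) (simp_all add: tableau_term_def mult.assoc)
qed

lemma zval_tab:
  assumes "diagram \<mu> = {d1, d2, d3, d4}" "distinct [d1, d2, d3, d4]" "i \<in> {1..4}"
  shows "zval (\<mu>, tab d1 d2 d3 d4) i =
    (case [d1, d2, d3, d4] ! (i - 1) of (r, c) \<Rightarrow> qt_mono (int (c - 1)) (int (r - 1)))"
proof -
  have "inj_on (tab d1 d2 d3 d4) (diagram \<mu>)"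
    unfolding assms(1) using assms(2) by (auto simp: inj_on_def tab_def)
  moreover have i: "i = 1 \<or> i = 2 \<or> i = 3 \<or> i = 4" using assms(3) by auto
  ultimately have "the_inv_into (diagram \<mu>) (tab d1 d2 d3 d4) i = [d1, d2, d3, d4] ! (i - 1)"
    using assms(2) by (intro the_inv_into_f_eq) (auto simp: assms(1) tab_def)
  then show ?thesis by (simp add: zval_def qt_mono_def split: prod.split)
qed

lemma tableau_term_tab:
  assumes "diagram \<mu> = {(1,1), (r2,c2), (r3,c3), (r4,c4)}" "distinct [(1,1), (r2,c2), (r3,c3), (r4,c4)]"
  defines "e \<equiv> \<lambda>i. int ([1, c2, c3, c4] ! (i - 1) - 1)" and "f \<equiv> \<lambda>i. int ([1, r2, r3, r4] ! (i - 1) - 1)"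
  shows "tableau_term a b c (\<mu>, tab (1,1) (r2,c2) (r3,c3) (r4,c4)) =
    qt_mono (e 2) (f 2) powi a * qt_mono (e 3) (f 3) powi b * qt_mono (e 4) (f 4) powi c *
    ((\<Prod>i\<in>{2,3,4}. 1 / (fac (- e i) (- f i) * fac (1 + e (i - 1) - e i) (1 + f (i - 1) - f i))) *
    (\<Prod>(i, j)\<in>{(1,2),(1,3),(1,4),(2,3),(2,4),(3,4)}.
      fac (e i - e j) (f i - f j) * fac (1 + e i - e j) (1 + f i - f j) /
      (fac (1 + e i - e j) (f i - f j) * fac (e i - e j) (1 + f i - f j))))"
proof -
  have z: "zval (\<mu>, tab (1,1) (r2,c2) (r3,c3) (r4,c4)) i = qt_mono (e i) (f i)" if "i \<in> {1..4}" for i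
  proof -
    have "i = 1 \<or> i = 2 \<or> i = 3 \<or> i = 4" using that by auto
    then show ?thesis using zval_tab[OF assms(1,2) that] by (auto simp: e_def f_def)
  qed
  have "zval (\<mu>, tab (1,1) (r2,c2) (r3,c3) (r4,c4)) 2 = qt_mono (e 2) (f 2)"
    "zval (\<mu>, tab (1,1) (r2,c2) (r3,c3) (r4,c4)) 3 = qt_mono (e 3) (f 3)"
    "zval (\<mu>, tab (1,1) (r2,c2) (r3,c3) (r4,c4)) 4 = qt_mono (e 4) (f 4)"
    by (rule z; simp)+
  then show ?thesis
    unfolding tableau_term_def by (simp only: wt_4_mono[of "zval (\<mu>, tab (1,1) (r2,c2) (r3,c3) (r4,c4))", OF z])
qed

text \<open>All cancellations are between \<open>fac\<close> symbols with equal exponents, so their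
  values are never expanded; omitted factors appear as \<open>fac 0 0 = 1\<close>.\<close>

lemma tableau_terms:
  "tableau_term a b c ([4], tab (1,1) (1,2) (1,3) (1,4)) =
     q powi a * (q\<^sup>2) powi b * (q ^ 3) powi c / (fac (-1) 1 * fac (-2) 1 * fac (-3) 1)"
  "tableau_term a b c ([3,1], tab (1,1) (1,2) (1,3) (2,1)) =
     q powi a * (q\<^sup>2) powi b * t powi c / (fac (-1) 1 * fac (-2) 1 * fac 3 (-1))"
  "tableau_term a b c ([3,1], tab (1,1) (1,2) (2,1) (1,3)) =
     q powi a * t powi b * (q\<^sup>2) powi c * fac 0 1 / (fac (-1) 1 ^ 2 * fac 2 (-1) * fac (-2) 2)"
  "tableau_term a b c ([3,1], tab (1,1) (2,1) (1,2) (1,3)) =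
     t powi a * q powi b * (q\<^sup>2) powi c / (fac 1 (-1) * fac (-1) 1 * fac (-2) 2)"
  "tableau_term a b c ([2,2], tab (1,1) (1,2) (2,1) (2,2)) =
     q powi a * t powi b * (q * t) powi c * fac 1 0 / (fac (-1) 1 ^ 2 * fac 1 (-1) * fac 2 (-1))"
  "tableau_term a b c ([2,2], tab (1,1) (2,1) (1,2) (2,2)) =
     t powi a * q powi b * (q * t) powi c * fac 0 1 / (fac 1 (-1) ^ 2 * fac (-1) 1 * fac (-1) 2)"
  "tableau_term a b c ([2,1,1], tab (1,1) (2,1) (1,2) (3,1)) =
     t powi a * q powi b * (t\<^sup>2) powi c * fac 1 0 / (fac 1 (-1) ^ 2 * fac (-1) 2 * fac 2 (-2))"
  "tableau_term a b c ([2,1,1], tab (1,1) (1,2) (2,1) (3,1)) =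
     q powi a * t powi b * (t\<^sup>2) powi c / (fac (-1) 1 * fac 1 (-1) * fac 2 (-2))"
  "tableau_term a b c ([2,1,1], tab (1,1) (2,1) (3,1) (1,2)) =
     t powi a * (t\<^sup>2) powi b * q powi c / (fac 1 (-1) * fac 1 (-2) * fac (-1) 3)"
  "tableau_term a b c ([1,1,1,1], tab (1,1) (2,1) (3,1) (4,1)) =
     t powi a * (t\<^sup>2) powi b * (t ^ 3) powi c / (fac 1 (-1) * fac 1 (-2) * fac 1 (-3))"
  by (subst tableau_term_tab, force simp: diagram_4 simp del: One_nat_def, simp,
      simp add: qt_mono_def divide_simps power2_eq_square)+

lemma F_explicit:
  "F [a, b, c] =
     q powi a * (q\<^sup>2) powi b * (q ^ 3) powi c / (fac (-1) 1 * fac (-2) 1 * fac (-3) 1)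
   + q powi a * (q\<^sup>2) powi b * t powi c / (fac (-1) 1 * fac (-2) 1 * fac 3 (-1))
   + q powi a * t powi b * (q\<^sup>2) powi c * fac 0 1 / (fac (-1) 1 ^ 2 * fac 2 (-1) * fac (-2) 2)
   + t powi a * q powi b * (q\<^sup>2) powi c / (fac 1 (-1) * fac (-1) 1 * fac (-2) 2)
   + q powi a * t powi b * (q * t) powi c * fac 1 0 / (fac (-1) 1 ^ 2 * fac 1 (-1) * fac 2 (-1))
   + t powi a * q powi b * (q * t) powi c * fac 0 1 / (fac 1 (-1) ^ 2 * fac (-1) 1 * fac (-1) 2)
   + t powi a * q powi b * (t\<^sup>2) powi c * fac 1 0 / (fac 1 (-1) ^ 2 * fac (-1) 2 * fac 2 (-2))
   + q powi a * t powi b * (t\<^sup>2) powi c / (fac (-1) 1 * fac 1 (-1) * fac 2 (-2))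
   + t powi a * (t\<^sup>2) powi b * q powi c / (fac 1 (-1) * fac 1 (-2) * fac (-1) 3)
   + t powi a * (t\<^sup>2) powi b * (t ^ 3) powi c / (fac 1 (-1) * fac 1 (-2) * fac 1 (-3))"
proof -
  \<comment> \<open>Summing over the enumerated set requires its ten elements to be distinct; within
    one shape this is decided by the order of the cells.\<close>
  have ne: "tab d1 d2 d3 d4 = tab e1 e2 e3 e4 \<longleftrightarrow> d1 = e1 \<and> d2 = e2 \<and> d3 = e3 \<and> d4 = e4"
    if "distinct [d1, d2, d3, d4]" for d1 d2 d3 d4 e1 e2 e3 e4
    using tab_inject[OF that] by blast
  show ?thesis
    unfolding F_4 SYT_4
    by (simp add: ne tableau_terms add.assoc del: One_nat_def)
qed

section \<open>The tableau sum as the bracket sum\<close>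

lemma (in triple) sum_box_iterated:
  "sum h box = (\<Sum>z\<in>{0..c}. \<Sum>y\<in>{z..b + c}. h (y, z))"
  for h :: "int \<times> int \<Rightarrow> 'a::comm_monoid_add"
proof -
  have "sum h box = (\<Sum>(z, y)\<in>(SIGMA z:{0..c}. {z..b + c}). h (y, z))"
    by (rule sum.reindex_bij_witness[of _ "\<lambda>(z, y). (y, z)" "\<lambda>(y, z). (z, y)"]) (auto simp: box_def)
  then show ?thesis by (simp add: sum.Sigma)
qed

lemma F_eq_box_sums:
  fixes a b c :: int
  assumes "0 \<le> c" "c \<le> b + 1"
  shows "(q - t) * F [a, b, c] =
      q powi (a + 1) * (\<Sum>z\<in>{0..c}. \<Sum>y\<in>{z..b + c}. q powi (2 * b + 3 * c - 2 * y - z) * t powi (y + max 0 (y + z - b - c)))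
    - t powi (a + 1) * (\<Sum>z\<in>{0..c}. \<Sum>y\<in>{z..b + c}. t powi (2 * b + 3 * c - 2 * y - z) * q powi (y + max 0 (y + z - b - c)))"
proof -
  note neq = qt_power_eq_iff[of 1 0 0 1] qt_power_eq_iff[of 2 0 0 1] qt_power_eq_iff[of 2 0 0 2] qt_power_eq_iff[of 3 0 0 1]
    qt_power_eq_iff[of 0 2 1 0] qt_power_eq_iff[of 0 3 1 0]
  have facs: "1 - t / q = fac (-1) 1" "1 - t / q\<^sup>2 = fac (-2) 1" "1 - t / q ^ 3 = fac (-3) 1"
    "1 - q ^ 3 / t = fac 3 (-1)" "1 - q\<^sup>2 / t = fac 2 (-1)" "1 - t\<^sup>2 / q\<^sup>2 = fac (-2) 2"
    "1 - q / t = fac 1 (-1)" "1 - q\<^sup>2 / t\<^sup>2 = fac 2 (-2)" "1 - q = fac 1 0" "1 - t = fac 0 1"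
    "1 - q / t\<^sup>2 = fac 1 (-2)" "1 - q / t ^ 3 = fac 1 (-3)" "1 - t ^ 3 / q = fac (-1) 3" "1 - t\<^sup>2 / q = fac (-1) 2"
    by (simp_all add: fac_eq qt_mono_def power_int_minus divide_simps)
  have U: "(\<Sum>z\<in>{0..c}. \<Sum>y\<in>{z..b + c}. q powi (2 * b + 3 * c - 2 * y - z) * t powi (y + max 0 (y + z - b - c))) =
      1 / (fac (-2) 1 * fac (-3) 1) * (q powi b) ^ 2 * (q powi c) ^ 3
    + 1 / (fac (-2) 1 * fac 3 (-1)) * (q powi b) ^ 2 * t powi c
    + fac 0 1 / (fac (-1) 1 * fac 2 (-1) * fac (-2) 2) * t powi b * (q powi c)\<^sup>2
    + fac 1 0 / (fac (-1) 1 * fac 1 (-1) * fac 2 (-1)) * t powi b * (q powi c * t powi c)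
    + 1 / (fac 1 (-1) * fac 2 (-2)) * t powi b * (t powi c)\<^sup>2"
    unfolding facs[symmetric] by (rule sum_box_closed) (use neq assms in auto)
  \<comment> \<open>Exchanging q and t transposes the tableaux, so this gives the five with second
    content t.\<close>
  have V: "(\<Sum>z\<in>{0..c}. \<Sum>y\<in>{z..b + c}. t powi (2 * b + 3 * c - 2 * y - z) * q powi (y + max 0 (y + z - b - c))) =
      1 / (fac 1 (-2) * fac 1 (-3)) * (t powi b) ^ 2 * (t powi c) ^ 3
    + 1 / (fac 1 (-2) * fac (-1) 3) * (t powi b) ^ 2 * q powi c
    + fac 1 0 / (fac 1 (-1) * fac (-1) 2 * fac 2 (-2)) * q powi b * (t powi c)\<^sup>2
    + fac 0 1 / (fac 1 (-1) * fac (-1) 1 * fac (-1) 2) * q powi b * (t powi c * q powi c)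
    + 1 / (fac (-1) 1 * fac (-2) 2) * q powi b * (q powi c)\<^sup>2"
    unfolding facs[symmetric] by (rule sum_box_closed) (use neq assms in auto)
  have powers: "(x ^ n) powi m = (x powi m) ^ n" for x :: qt_field and n m
    by (simp add: power_int_power power_int_power' mult.commute)
  have 1: "q - t = q * fac (-1) 1" "q - t = - t * fac 1 (-1)"
    unfolding facs[symmetric] by (simp_all add: divide_simps)
  \<comment> \<open>In \<open>F_explicit\<close> each denominator begins with
    \<open>fac (-1) 1\<close> or \<open>fac 1 (-1)\<close>, according as the second content is q or
    t. Multiplication by q - t replaces this factor by q or -t, which raises the outer exponent from
    \<open>a\<close> to \<open>a + 1\<close>.\<close>
  have q1: "(q - t) * (x / (fac (-1) 1 * y)) = q * (x / y)" and t1: "(q - t) * (x / (fac 1 (-1) * y)) = - (t * (x / y))" for x y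
    by (subst 1(1), simp) (subst 1(2), simp)
  show ?thesis
    unfolding F_explicit U V powers power_int_mult_distrib distrib_left power2_eq_square[of "fac _ _"] mult.assoc q1 t1
    by (simp add: power_int_add algebra_simps)
qed

theorem theorem3p5:
  fixes a b c :: int
  assumes "a \<ge> 0" and "b \<ge> 0" and "c \<ge> 0"
    and "a + 1 \<ge> b" and "a + 1 \<ge> c" and "b + 1 \<ge> c"
  shows "F [a, b, c] = (\<Sum>l\<in>subpartitions a b c. q powi area a b c l * t powi stat a b c l)"
proof -
  interpret triple a b c using assms by unfold_locales
  let ?w = "\<lambda>m n. q powi m * t powi n"
  \<comment> \<open>The product (q - t) q^m t^n is the difference
    \<open>?w (m + 1) n - ?w m (n + 1)\<close>, so \<open>f\<close> applies with this
    \<open>?w\<close>.\<close>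
  have "(q - t) * (\<Sum>l\<in>subpartitions a b c. q powi area a b c l * t powi stat a b c l) = sum (f ?w) (subpartitions a b c)"
    unfolding sum_distrib_left by (rule sum.cong) (simp_all add: f_def power_int_add algebra_simps)
  also have "\<dots> = (\<Sum>z\<in>{0..c}. \<Sum>y\<in>{z..b + c}.
      q powi (a + 1) * (q powi (2 * b + 3 * c - 2 * y - z) * t powi (y + max 0 (y + z - b - c)))
    - t powi (a + 1) * (t powi (2 * b + 3 * c - 2 * y - z) * q powi (y + max 0 (y + z - b - c))))"
    unfolding sum_f_eq_box sum_box_iterated prod.case
  proof (intro sum.cong refl)
    fix y z
    have e: "a + 2 * b + 3 * c + 1 - 2 * y - z = (a + 1) + (2 * b + 3 * c - 2 * y - z)" by simp
    have "x powi (a + 2 * b + 3 * c + 1 - 2 * y - z) = x powi (a + 1) * x powi (2 * b + 3 * c - 2 * y - z)"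
      if "x \<noteq> 0" for x :: qt_field
      unfolding e by (rule power_int_add) (use that in simp)
    then show "?w (a + 2 * b + 3 * c + 1 - 2 * y - z) (y + max 0 (y + z - b - c))
      - ?w (y + max 0 (y + z - b - c)) (a + 2 * b + 3 * c + 1 - 2 * y - z) =
      q powi (a + 1) * (q powi (2 * b + 3 * c - 2 * y - z) * t powi (y + max 0 (y + z - b - c)))
    - t powi (a + 1) * (t powi (2 * b + 3 * c - 2 * y - z) * q powi (y + max 0 (y + z - b - c)))"
      by (simp add: mult_ac)
  qed
  also have "\<dots> = (q - t) * F [a, b, c]"
    using assms by (simp only: F_eq_box_sums sum_subtractf sum_distrib_left)
  finally show ?thesis
    using qt_power_eq_iff[of 1 0 0 1] by auto
qed

end
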